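(* Let $\pi$ be a groupoid, $V$ a $\pi$-graded vector space of finite type over $\mathbb{C}$, $\bar q,\bar\nu:\mathrm{Ob}(\pi)\to\mathbb{C}\setminus\{0\}$ two maps, and $U(a)$, $a\in\mathrm{Ob}(\pi)$, a local dynamical Birman--Murakami--Wenzl operator on $V$ associated with $\bar q,\bar\nu$, with corresponding $K(a)=\mathrm{id}-\frac{U(a)-U^{-1}(a)}{\bar q(a)-\bar q^{-1}(a)}$. Suppose that $\bar q(a)=\bar q(b)$ and $\bar\nu(a)=\bar\nu(b)$ whenever there exists an arrow $\alpha\in\pi$ with $s(\alpha)=a$, $t(\alpha)=b$. Define $$\check R(u,v)[a]:=U(a)+\frac{\bar q(a)-\bar q^{-1}(a)}{v/u-1}+\frac{\bar q(a)-\bar q^{-1}(a)}{1+\bar\nu^{-1}(a)\,\bar q(a)\,v/u}\,K(a).$$ Then, for all $a\in\mathrm{Ob}(\pi)$ and all $u_1,u_2,u_3$ for which the expressions are defined, the following two-parameter dynamical Yang--Baxter equation holds: $$\check R^{(12)}(u_2,u_3)[a]\,\check R^{(23)}(u_1,u_3)[ah^{(1)}]\,\check R^{(12)}(u_1,u_2)[a]=\check R^{(23)}(u_1,u_2)[ah^{(1)}]\,\check R^{(12)}(u_1,u_3)[a]\,\check R^{(23)}(u_2,u_3)[ah^{(1)}].$$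
   Context: A groupoid $\pi$ is a small category in which every morphism (arrow) is invertible; $s,t:\pi\to\mathrm{Ob}(\pi)$ are source and target, and $\beta\circ\alpha$ is defined when $t(\alpha)=s(\beta)$. A $\pi$-graded vector space of finite type over $\mathbb{C}$ is a collection $V=(V_\alpha)_{\alpha\in\pi}$ of finite dimensional vector spaces indexed by the arrows such that for each object $a$ there are only finitely many arrows $\alpha$ with source or target $a$ and $V_\alpha\neq0$. Tensor products are defined by $(V\otimes W)_\gamma=\bigoplus_{\beta\circ\alpha=\gamma}V_\alpha\otimes W_\beta$. For a family $X(a)\in\bigoplus_{\alpha\in s^{-1}(a)}\mathrm{End}_{\mathbb{C}}((V\otimes V)_\alpha)$, $a\in\mathrm{Ob}(\pi)$, and for $u\otimes v\otimes w\in V_{\alpha_1}\otimes V_{\alpha_2}\otimes V_{\alpha_3}$ with $\alpha_1,\alpha_2,\alpha_3$ composable and $s(\alpha_1)=a$, set $X^{(12)}(a)(u\otimes v\otimes w)=X(a)(u\otimes v)\otimes w$ and $X^{(23)}(ah^{(1)})(u\otimes v\otimes w)=u\otimes X(t(\alpha_1))(v\otimes w)$. For a function $g$ on $\mathrm{Ob}(\pi)$, $g(ah^{(1)})$ denotes multiplication by $g(t(\alpha_1))$ on such vectors. $\bar q^{-1}(a)=1/\bar q(a)$, $\bar\nu^{-1}(a)=1/\bar\nu(a)$. Scalars in operator expressions mean multiples of the identity. A local dynamical Birman--Murakami--Wenzl operator on $V$ associated to $\bar q,\bar\nu$ (with $\bar q(a)\ne\bar q^{-1}(a)$ for all $a$)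 is a family of invertible operators $U(a)\in\bigoplus_{\alpha\in s^{-1}(a)}\mathrm{End}_{\mathbb{C}}((V\otimes V)_\alpha)$ such that, with $K(a)=\mathrm{id}-\frac{U(a)-U^{-1}(a)}{\bar q(a)-\bar q^{-1}(a)}$, for all $a$ and $\epsilon=\pm1$: (i) $U^{(12)}(a)U^{(23)}(ah^{(1)})U^{(12)}(a)=U^{(23)}(ah^{(1)})U^{(12)}(a)U^{(23)}(ah^{(1)})$; (ii) $K(a)U(a)=U(a)K(a)=\bar\nu(a)K(a)$; (iii) $K^{(23)}(ah^{(1)})(U^{\epsilon})^{(12)}(a)K^{(23)}(ah^{(1)})=\bar\nu^{-\epsilon}(ah^{(1)})K^{(23)}(ah^{(1)})$; (iv) $K^{(12)}(a)(U^{\epsilon})^{(23)}(ah^{(1)})K^{(12)}(a)=\bar\nu^{-\epsilon}(a)K^{(12)}(a)$. *)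

theory Defs
  imports Complex_Main "HOL-Library.Poly_Mapping"
begin

section \<open>Complex vector spaces\<close>

class complex_vector = ab_group_add +
  fixes scaleC :: "complex \<Rightarrow> 'a \<Rightarrow> 'a"  (infixr "*\<^sub>C" 75)
  assumes scaleC_add_right: "c *\<^sub>C (x + y) = c *\<^sub>C x + c *\<^sub>C y"
    and scaleC_add_left: "(c + d) *\<^sub>C x = c *\<^sub>C x + d *\<^sub>C x"
    and scaleC_scaleC: "c *\<^sub>C d *\<^sub>C x = (c * d) *\<^sub>C x"
    and scaleC_one: "1 *\<^sub>C x = x"

interpretation cvec: vector_space "scaleC :: complex \<Rightarrow> 'a \<Rightarrow> 'a::complex_vector"
  by standard (fact scaleC_add_right scaleC_add_left scaleC_scaleC scaleC_one)+

instantiation complex :: complex_vector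
begin
definition scaleC_complex :: "complex \<Rightarrow> complex \<Rightarrow> complex"
  where "scaleC_complex c x = c * x"
instance by standard (simp_all add: scaleC_complex_def algebra_simps)
end

instantiation poly_mapping :: (type, complex_vector) complex_vector
begin
definition scaleC_poly_mapping :: "complex \<Rightarrow> ('a \<Rightarrow>\<^sub>0 'b) \<Rightarrow> ('a \<Rightarrow>\<^sub>0 'b)"
  where "scaleC_poly_mapping c = Poly_Mapping.map (scaleC c)"

lemma lookup_scaleC:
  fixes p :: "'a \<Rightarrow>\<^sub>0 'b"
  shows "Poly_Mapping.lookup (c *\<^sub>C p) k = c *\<^sub>C Poly_Mapping.lookup p k"
  by (simp add: scaleC_poly_mapping_def map.rep_eq when_def)

instance
  by standard
    (simp_all add: poly_mapping_eq_iff fun_eq_iff lookup_scaleC lookup_add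
      scaleC_add_right scaleC_add_left scaleC_scaleC scaleC_one)
end

section \<open>Tensor products\<close>

text \<open>The tensor product of two complex vector spaces: the free vector space on the set of
  pairs, modulo the subspace generated by the bilinearity relations.\<close>

definition bilinearity_relations ::
    "(('v::complex_vector \<times> 'w::complex_vector) \<Rightarrow>\<^sub>0 complex) set"
  where "bilinearity_relations =
      {Poly_Mapping.single (u + u', v) 1 - Poly_Mapping.single (u, v) 1
         - Poly_Mapping.single (u', v) 1 | u u' v. True}
    \<union> {Poly_Mapping.single (u, v + v') 1 - Poly_Mapping.single (u, v) 1
         - Poly_Mapping.single (u, v') 1 | u v v'. True}
    \<union> {Poly_Mapping.single (c *\<^sub>C u, v) 1 - Poly_Mapping.single (u, v) c | c u v. True}
    \<union> {Poly_Mapping.single (u, c *\<^sub>C v) 1 - Poly_Mapping.single (u, v) c | c u v. True}"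

quotient_type (overloaded) ('v, 'w) tensor =
    "('v::complex_vector \<times> 'w::complex_vector) \<Rightarrow>\<^sub>0 complex" /
    "\<lambda>p q. p - q \<in> cvec.span bilinearity_relations"
proof (rule equivpI)
  show "reflp (\<lambda>p q. p - q \<in> cvec.span
      (bilinearity_relations :: (('v \<times> 'w) \<Rightarrow>\<^sub>0 complex) set))"
    by (simp add: reflp_def cvec.span_zero)
  show "symp (\<lambda>p q. p - q \<in> cvec.span
      (bilinearity_relations :: (('v \<times> 'w) \<Rightarrow>\<^sub>0 complex) set))"
    using cvec.span_neg by (fastforce simp: symp_def)
  show "transp (\<lambda>p q. p - q \<in> cvec.span
      (bilinearity_relations :: (('v \<times> 'w) \<Rightarrow>\<^sub>0 complex) set))"
    using cvec.span_add by (fastforce simp: transp_def)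
qed

instantiation tensor :: (complex_vector, complex_vector) complex_vector
begin

lift_definition zero_tensor :: "('a, 'b) tensor" is 0 .

lift_definition plus_tensor :: "('a, 'b) tensor \<Rightarrow> ('a, 'b) tensor \<Rightarrow> ('a, 'b) tensor" is plus
  by (metis add_diff_add cvec.span_add)

lift_definition uminus_tensor :: "('a, 'b) tensor \<Rightarrow> ('a, 'b) tensor" is uminus
  by (metis cvec.span_neg minus_diff_minus)

lift_definition minus_tensor :: "('a, 'b) tensor \<Rightarrow> ('a, 'b) tensor \<Rightarrow> ('a, 'b) tensor" is minus
proof -
  fix p p' q q' :: "('a \<times> 'b) \<Rightarrow>\<^sub>0 complex"
  assume "p - p' \<in> cvec.span bilinearity_relations" "q - q' \<in> cvec.span bilinearity_relations"
  then have "(p - p') - (q - q') \<in> cvec.span bilinearity_relations"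
    by (rule cvec.span_diff)
  then show "(p - q) - (p' - q') \<in> cvec.span bilinearity_relations"
    by (simp add: algebra_simps)
qed

lift_definition scaleC_tensor :: "complex \<Rightarrow> ('a, 'b) tensor \<Rightarrow> ('a, 'b) tensor" is scaleC
  by (metis cvec.scale_right_diff_distrib cvec.span_scale)

instance
  by standard
    (transfer, simp add: algebra_simps cvec.span_zero scaleC_add_right scaleC_add_left
      scaleC_scaleC scaleC_one)+
end

lift_definition tensor_pure ::
    "'v::complex_vector \<Rightarrow> 'w::complex_vector \<Rightarrow> ('v, 'w) tensor"  (infixr "\<otimes>" 72)
  is "\<lambda>u v. Poly_Mapping.single (u, v) 1" .

definition linear_extend ::
    "('k \<Rightarrow> 'b::zero \<Rightarrow> 'z::comm_monoid_add) \<Rightarrow> ('k \<Rightarrow>\<^sub>0 'b) \<Rightarrow> 'z"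
  where "linear_extend F p = (\<Sum>k\<in>Poly_Mapping.keys p. F k (Poly_Mapping.lookup p k))"

definition tensor_lift ::
    "('v::complex_vector \<Rightarrow> 'w::complex_vector \<Rightarrow> 'z::complex_vector) \<Rightarrow> ('v, 'w) tensor \<Rightarrow> 'z"
  where "tensor_lift f t = linear_extend (\<lambda>(u, v) c. c *\<^sub>C f u v) (rep_tensor t)"

abbreviation clinear :: "('v::complex_vector \<Rightarrow> 'w::complex_vector) \<Rightarrow> bool"
  where "clinear \<equiv> Vector_Spaces.linear scaleC scaleC"

definition bilinear_map ::
    "('v::complex_vector \<Rightarrow> 'w::complex_vector \<Rightarrow> 'z::complex_vector) \<Rightarrow> bool"
  where "bilinear_map f \<longleftrightarrow> (\<forall>u. clinear (f u)) \<and> (\<forall>v. clinear (\<lambda>u. f u v))"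

lemma clinearI:
  assumes "\<And>x y. f (x + y) = f x + f y" "\<And>c x. f (c *\<^sub>C x) = c *\<^sub>C f x"
  shows "clinear f"
  by unfold_locales (auto simp: assms)

lemma clinear_add: "clinear f \<Longrightarrow> f (x + y) = f x + f y"
  and clinear_scale: "clinear f \<Longrightarrow> f (c *\<^sub>C x) = c *\<^sub>C f x"
  and clinear_diff: "clinear f \<Longrightarrow> f (x - y) = f x - f y"
  and clinear_zero: "clinear f \<Longrightarrow> f 0 = 0"
  unfolding linear_iff_module_hom
  by (fact module_hom.add module_hom.scale module_hom.diff module_hom.zero)+

lemma linear_extend_single [simp]: "(\<And>k. F k 0 = 0) \<Longrightarrow> linear_extend F (Poly_Mapping.single k b) = F k b"
  by (simp add: linear_extend_def)

lemma clinear_linear_extend: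
  fixes F :: "'k \<Rightarrow> 'b::complex_vector \<Rightarrow> 'z::complex_vector"
  assumes "\<And>k. clinear (F k)"
  shows "clinear (linear_extend F)"
proof (rule clinearI)
  have *: "linear_extend F p = (\<Sum>k\<in>A. F k (Poly_Mapping.lookup p k))"
    if "finite A" "Poly_Mapping.keys p \<subseteq> A" for p A
    unfolding linear_extend_def
    by (rule sum.mono_neutral_left) (use that in \<open>auto simp: in_keys_iff clinear_zero[OF assms]\<close>)
  show "linear_extend F (x + y) = linear_extend F x + linear_extend F y" for x y
    using Poly_Mapping.keys_add[of x y]
    by (simp add: *[of "Poly_Mapping.keys x \<union> Poly_Mapping.keys y"] lookup_add
        clinear_add[OF assms] sum.distrib)
  show "linear_extend F (c *\<^sub>C x) = c *\<^sub>C linear_extend F x" for c x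
  proof -
    have "Poly_Mapping.keys (c *\<^sub>C x) \<subseteq> Poly_Mapping.keys x"
      by (auto simp: in_keys_iff lookup_scaleC)
    then show ?thesis
      by (simp add: *[of "Poly_Mapping.keys x"] lookup_scaleC clinear_scale[OF assms]
          cvec.scale_sum_right)
  qed
qed

lemma tensor_pure_add_left: "(u + u') \<otimes> v = u \<otimes> v + u' \<otimes> v"
  by (transfer, rule cvec.span_base, subst diff_diff_eq [symmetric])
    (unfold bilinearity_relations_def, blast)

lemma tensor_pure_add_right: "u \<otimes> (v + v') = u \<otimes> v + u \<otimes> v'"
  by (transfer, rule cvec.span_base, subst diff_diff_eq [symmetric])
    (unfold bilinearity_relations_def, blast)

lemma scaleC_single: "c *\<^sub>C Poly_Mapping.single k b = Poly_Mapping.single k (c *\<^sub>C b)"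
  by (rule poly_mapping_eqI) (simp add: lookup_scaleC lookup_single when_def)

lemma tensor_pure_scale_left: "(c *\<^sub>C u) \<otimes> v = c *\<^sub>C (u \<otimes> v)"
  by (transfer, rule cvec.span_base, simp add: scaleC_single scaleC_complex_def)
    (unfold bilinearity_relations_def, blast)

lemma tensor_pure_scale_right: "u \<otimes> (c *\<^sub>C v) = c *\<^sub>C (u \<otimes> v)"
  by (transfer, rule cvec.span_base, simp add: scaleC_single scaleC_complex_def)
    (unfold bilinearity_relations_def, blast)

lemma bilinear_map_tensor_pure: "bilinear_map (\<otimes>)"
  unfolding bilinear_map_def
  by (auto intro!: clinearI simp: tensor_pure_add_left tensor_pure_add_right
      tensor_pure_scale_left tensor_pure_scale_right)

lemma linear_extend_eq_tensor_lift:
  assumes f: "bilinear_map f"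
  shows "tensor_lift f (abs_tensor p) = linear_extend (\<lambda>(u, v) c. c *\<^sub>C f u v) p"
proof -
  let ?L = "linear_extend (\<lambda>(u, v) c. c *\<^sub>C f u v)"
  have L: "clinear ?L"
    by (rule clinear_linear_extend)
      (auto intro!: clinearI simp: scaleC_add_left scaleC_scaleC scaleC_complex_def)
  have single: "?L (Poly_Mapping.single (u, v) c) = c *\<^sub>C f u v" for u v c
    by (subst linear_extend_single) auto
  have f': "f (u + u') v = f u v + f u' v" "f u (v + v') = f u v + f u v'"
    "f (c *\<^sub>C u) v = c *\<^sub>C f u v" "f u (c *\<^sub>C v) = c *\<^sub>C f u v" for u u' v v' c
    using f by (auto simp: bilinear_map_def clinear_add clinear_scale
        clinear_add [of "\<lambda>u. f u _"] clinear_scale [of "\<lambda>u. f u _"])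
  have rel: "?L r = 0" if "r \<in> cvec.span bilinearity_relations" for r
    using that
  proof (induction rule: cvec.span_induct_alt)
    case base
    show ?case by (rule clinear_zero [OF L])
  next
    case (step c x y)
    have "?L x = 0"
      using step(1) by (auto simp: bilinearity_relations_def clinear_diff [OF L] single f' scaleC_one)
    then show ?case
      by (simp add: clinear_add [OF L] clinear_scale [OF L] step)
  qed
  have "rep_tensor (abs_tensor p) - p \<in> cvec.span bilinearity_relations"
    by (rule Quotient_rep_abs [OF Quotient_tensor]) (simp add: cvec.span_zero)
  then have "?L (rep_tensor (abs_tensor p) - p) = 0"
    by (rule rel)
  then show ?thesis
    by (simp add: tensor_lift_def clinear_diff [OF L])
qed

lemma tensor_induct [case_names zero add]:
  assumes zero: "P 0"
    and add: "\<And>c u v t. P t \<Longrightarrow> P (c *\<^sub>C (u \<otimes> v) + t)"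
  shows "P t"
proof (induction t rule: tensor.abs_induct)
  case (1 p)
  show ?case
  proof (induction p rule: update_induct)
    case const
    show ?case
      using zero by (simp add: zero_tensor.abs_eq)
  next
    case (update p k c)
    have "Poly_Mapping.update k c p = c *\<^sub>C Poly_Mapping.single k 1 + p"
      using update(1) by (intro poly_mapping_eqI)
        (auto simp: lookup_update lookup_add lookup_scaleC lookup_single when_def
          scaleC_complex_def in_keys_iff)
    then have "abs_tensor (Poly_Mapping.update k c p)
        = c *\<^sub>C (fst k \<otimes> snd k) + abs_tensor p"
      by (simp add: plus_tensor.abs_eq scaleC_tensor.abs_eq tensor_pure.abs_eq)
    then show ?case
      using add [OF update(3)] by simp
  qed
qed

text \<open>The universal property of the tensor product.\<close>

theorem tensor_universal:
  assumes f: "bilinear_map f"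
  shows "clinear (tensor_lift f)" and "tensor_lift f (u \<otimes> v) = f u v"
    and "\<lbrakk>clinear g; \<And>u v. g (u \<otimes> v) = f u v\<rbrakk> \<Longrightarrow> g = tensor_lift f"
proof -
  let ?L = "linear_extend (\<lambda>(u, v) c. c *\<^sub>C f u v)"
  have L: "clinear ?L"
    by (rule clinear_linear_extend)
      (auto intro!: clinearI simp: scaleC_add_left scaleC_scaleC scaleC_complex_def)
  show lin: "clinear (tensor_lift f)"
  proof (rule clinearI)
    show "tensor_lift f (x + y) = tensor_lift f x + tensor_lift f y" for x y
      by (induction x rule: tensor.abs_induct, induction y rule: tensor.abs_induct)
        (simp add: plus_tensor.abs_eq linear_extend_eq_tensor_lift [OF f] clinear_add [OF L])
    show "tensor_lift f (c *\<^sub>C x) = c *\<^sub>C tensor_lift f x" for c x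
      by (induction x rule: tensor.abs_induct)
        (simp add: scaleC_tensor.abs_eq linear_extend_eq_tensor_lift [OF f] clinear_scale [OF L])
  qed
  have pure: "tensor_lift f (u \<otimes> v) = f u v" for u v
    by (simp add: tensor_pure.abs_eq linear_extend_eq_tensor_lift [OF f],
        subst linear_extend_single) (auto simp: scaleC_one)
  show "tensor_lift f (u \<otimes> v) = f u v"
    by (rule pure)
  show "g = tensor_lift f" if g: "clinear g" "\<And>u v. g (u \<otimes> v) = f u v"
  proof
    show "g t = tensor_lift f t" for t
      by (induction t rule: tensor_induct)
        (simp_all add: clinear_zero clinear_add clinear_scale g lin pure)
  qed
qed

definition tensor_space ::
    "'v::complex_vector set \<Rightarrow> 'w::complex_vector set \<Rightarrow> ('v, 'w) tensor set"
  where "tensor_space S T = cvec.span {u \<otimes> v | u v. u \<in> S \<and> v \<in> T}"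

definition direct_sum :: "'i set \<Rightarrow> ('i \<Rightarrow> 'v::complex_vector set) \<Rightarrow> ('i \<Rightarrow>\<^sub>0 'v) set"
  where "direct_sum I S =
    {x. Poly_Mapping.keys x \<subseteq> I \<and> (\<forall>i\<in>I. Poly_Mapping.lookup x i \<in> S i)}"

definition linear_endo :: "'v::complex_vector set \<Rightarrow> ('v \<Rightarrow> 'v) \<Rightarrow> bool"
  where "linear_endo S f \<longleftrightarrow> (\<forall>x\<in>S. f x \<in> S) \<and>
    (\<forall>x\<in>S. \<forall>y\<in>S. f (x + y) = f x + f y) \<and> (\<forall>c. \<forall>x\<in>S. f (c *\<^sub>C x) = c *\<^sub>C f x)"

section \<open>Groupoids and graded vector spaces\<close>

text \<open>\<open>Cmp G \<beta> \<alpha>\<close> is the composite \<open>\<beta> \<circ> \<alpha>\<close>, meaningful when \<open>Tgt G \<alpha> = Src G \<beta>\<close>.\<close>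

record ('o, 'g) groupoid_data =
  Obj :: "'o set"
  Arr :: "'g set"
  Src :: "'g \<Rightarrow> 'o"
  Tgt :: "'g \<Rightarrow> 'o"
  Cmp :: "'g \<Rightarrow> 'g \<Rightarrow> 'g"
  Idt :: "'o \<Rightarrow> 'g"

locale groupoid =
  fixes G :: "('o, 'g) groupoid_data"
  assumes Src_Obj: "\<alpha> \<in> Arr G \<Longrightarrow> Src G \<alpha> \<in> Obj G"
    and Tgt_Obj: "\<alpha> \<in> Arr G \<Longrightarrow> Tgt G \<alpha> \<in> Obj G"
    and Idt_Arr: "a \<in> Obj G \<Longrightarrow> Idt G a \<in> Arr G"
    and Src_Idt: "a \<in> Obj G \<Longrightarrow> Src G (Idt G a) = a"
    and Tgt_Idt: "a \<in> Obj G \<Longrightarrow> Tgt G (Idt G a) = a"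
    and Cmp_Arr: "\<lbrakk>\<alpha> \<in> Arr G; \<beta> \<in> Arr G; Tgt G \<alpha> = Src G \<beta>\<rbrakk> \<Longrightarrow> Cmp G \<beta> \<alpha> \<in> Arr G"
    and Src_Cmp: "\<lbrakk>\<alpha> \<in> Arr G; \<beta> \<in> Arr G; Tgt G \<alpha> = Src G \<beta>\<rbrakk>
      \<Longrightarrow> Src G (Cmp G \<beta> \<alpha>) = Src G \<alpha>"
    and Tgt_Cmp: "\<lbrakk>\<alpha> \<in> Arr G; \<beta> \<in> Arr G; Tgt G \<alpha> = Src G \<beta>\<rbrakk>
      \<Longrightarrow> Tgt G (Cmp G \<beta> \<alpha>) = Tgt G \<beta>"
    and Cmp_assoc: "\<lbrakk>\<alpha> \<in> Arr G; \<beta> \<in> Arr G; \<gamma> \<in> Arr G; Tgt G \<alpha> = Src G \<beta>; Tgt G \<beta> = Src G \<gamma>\<rbrakk>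
      \<Longrightarrow> Cmp G \<gamma> (Cmp G \<beta> \<alpha>) = Cmp G (Cmp G \<gamma> \<beta>) \<alpha>"
    and Cmp_Idt_right: "\<alpha> \<in> Arr G \<Longrightarrow> Cmp G \<alpha> (Idt G (Src G \<alpha>)) = \<alpha>"
    and Cmp_Idt_left: "\<alpha> \<in> Arr G \<Longrightarrow> Cmp G (Idt G (Tgt G \<alpha>)) \<alpha> = \<alpha>"
    and inverse_ex: "\<alpha> \<in> Arr G \<Longrightarrow> \<exists>\<beta>\<in>Arr G. Src G \<beta> = Tgt G \<alpha> \<and> Tgt G \<beta> = Src G \<alpha> \<and>
      Cmp G \<beta> \<alpha> = Idt G (Src G \<alpha>) \<and> Cmp G \<alpha> \<beta> = Idt G (Tgt G \<alpha>)"

text \<open>The spaces \<open>V \<alpha>\<close> are subspaces of one ambient complex vector space \<open>'v\<close>. This is no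
  restriction, since every family of vector spaces embeds in its direct sum; nothing is assumed
  about the relative position of the \<open>V \<alpha>\<close>.\<close>

definition graded_finite_type ::
    "('o, 'g) groupoid_data \<Rightarrow> ('g \<Rightarrow> 'v::complex_vector set) \<Rightarrow> bool"
  where "graded_finite_type G V \<longleftrightarrow>
    (\<forall>\<alpha>\<in>Arr G. cvec.subspace (V \<alpha>) \<and> (\<exists>B. finite B \<and> V \<alpha> = cvec.span B)) \<and>
    (\<forall>a\<in>Obj G. finite {\<alpha> \<in> Arr G. (Src G \<alpha> = a \<or> Tgt G \<alpha> = a) \<and> V \<alpha> \<noteq> {0}})"

definition comp_pairs :: "('o, 'g) groupoid_data \<Rightarrow> 'g \<Rightarrow> ('g \<times> 'g) set"
  where "comp_pairs G \<gamma> = {(\<alpha>, \<beta>). \<alpha> \<in> Arr G \<and> \<beta> \<in> Arr G \<and> Tgt G \<alpha> = Src G \<beta> \<and> Cmp G \<beta> \<alpha> = \<gamma>}"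

definition comp_triples :: "('o, 'g) groupoid_data \<Rightarrow> 'g \<Rightarrow> ('g \<times> 'g \<times> 'g) set"
  where "comp_triples G \<gamma> = {(\<alpha>\<^sub>1, \<alpha>\<^sub>2, \<alpha>\<^sub>3). \<alpha>\<^sub>1 \<in> Arr G \<and> \<alpha>\<^sub>2 \<in> Arr G \<and> \<alpha>\<^sub>3 \<in> Arr G \<and>
    Tgt G \<alpha>\<^sub>1 = Src G \<alpha>\<^sub>2 \<and> Tgt G \<alpha>\<^sub>2 = Src G \<alpha>\<^sub>3 \<and> Cmp G \<alpha>\<^sub>3 (Cmp G \<alpha>\<^sub>2 \<alpha>\<^sub>1) = \<gamma>}"

type_synonym ('g, 'v) tensor2 = "('g \<times> 'g) \<Rightarrow>\<^sub>0 ('v, 'v) tensor"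
type_synonym ('g, 'v) tensor3 = "('g \<times> 'g \<times> 'g) \<Rightarrow>\<^sub>0 ('v, ('v, 'v) tensor) tensor"

text \<open>The components \<open>(V \<otimes> V)\<^sub>\<gamma>\<close> and \<open>(V \<otimes> V \<otimes> V)\<^sub>\<gamma>\<close>; threefold tensor products are bracketed
  to the right.\<close>

definition graded_tensor2 ::
    "('o, 'g) groupoid_data \<Rightarrow> ('g \<Rightarrow> 'v::complex_vector set) \<Rightarrow> 'g \<Rightarrow> ('g, 'v) tensor2 set"
  where "graded_tensor2 G V \<gamma> =
    direct_sum (comp_pairs G \<gamma>) (\<lambda>(\<alpha>, \<beta>). tensor_space (V \<alpha>) (V \<beta>))"

definition graded_tensor3 ::
    "('o, 'g) groupoid_data \<Rightarrow> ('g \<Rightarrow> 'v::complex_vector set) \<Rightarrow> 'g \<Rightarrow> ('g, 'v) tensor3 set"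
  where "graded_tensor3 G V \<gamma> =
    direct_sum (comp_triples G \<gamma>)
      (\<lambda>(\<alpha>\<^sub>1, \<alpha>\<^sub>2, \<alpha>\<^sub>3). tensor_space (V \<alpha>\<^sub>1) (tensor_space (V \<alpha>\<^sub>2) (V \<alpha>\<^sub>3)))"

definition pure2 :: "'g \<Rightarrow> 'v::complex_vector \<Rightarrow> 'g \<Rightarrow> 'v \<Rightarrow> ('g, 'v) tensor2"
  where "pure2 \<alpha> u \<beta> v = Poly_Mapping.single (\<alpha>, \<beta>) (u \<otimes> v)"

definition pure3 ::
    "'g \<Rightarrow> 'v::complex_vector \<Rightarrow> 'g \<Rightarrow> 'v \<Rightarrow> 'g \<Rightarrow> 'v \<Rightarrow> ('g, 'v) tensor3"
  where "pure3 \<alpha>\<^sub>1 u \<alpha>\<^sub>2 v \<alpha>\<^sub>3 w = Poly_Mapping.single (\<alpha>\<^sub>1, \<alpha>\<^sub>2, \<alpha>\<^sub>3) (u \<otimes> v \<otimes> w)"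

text \<open>\<open>append_right y \<alpha> w\<close> is \<open>y \<otimes> w\<close>, and \<open>append_left \<alpha> u y\<close> is \<open>u \<otimes> y\<close>, where \<open>y\<close> is a
  twofold tensor and \<open>w\<close>, respectively \<open>u\<close>, is of degree \<open>\<alpha>\<close>.\<close>

definition append_right ::
    "('g, 'v::complex_vector) tensor2 \<Rightarrow> 'g \<Rightarrow> 'v \<Rightarrow> ('g, 'v) tensor3"
  where "append_right y \<alpha> w = linear_extend
    (\<lambda>(\<beta>\<^sub>1, \<beta>\<^sub>2) z. Poly_Mapping.single (\<beta>\<^sub>1, \<beta>\<^sub>2, \<alpha>) (tensor_lift (\<lambda>u v. u \<otimes> v \<otimes> w) z)) y"

definition append_left ::
    "'g \<Rightarrow> 'v::complex_vector \<Rightarrow> ('g, 'v) tensor2 \<Rightarrow> ('g, 'v) tensor3"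
  where "append_left \<alpha> u y = linear_extend
    (\<lambda>(\<beta>\<^sub>1, \<beta>\<^sub>2) z. Poly_Mapping.single (\<alpha>, \<beta>\<^sub>1, \<beta>\<^sub>2) (u \<otimes> z)) y"

lemma append_right_pure2:
  fixes u v w :: "'v::complex_vector"
  shows "append_right (pure2 \<alpha>\<^sub>1 u \<alpha>\<^sub>2 v) \<alpha>\<^sub>3 w = pure3 \<alpha>\<^sub>1 u \<alpha>\<^sub>2 v \<alpha>\<^sub>3 w"
proof -
  have f: "bilinear_map (\<lambda>u v. u \<otimes> v \<otimes> w)"
    unfolding bilinear_map_def
    by (auto intro!: clinearI simp: tensor_pure_add_left tensor_pure_add_right
        tensor_pure_scale_left tensor_pure_scale_right)
  show ?thesis
    unfolding append_right_def pure2_def pure3_def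
    by (subst linear_extend_single)
      (auto simp: tensor_universal(2) [OF f] clinear_zero [OF tensor_universal(1) [OF f]])
qed

lemma append_left_pure2:
  fixes u v w :: "'v::complex_vector"
  shows "append_left \<alpha>\<^sub>1 u (pure2 \<alpha>\<^sub>2 v \<alpha>\<^sub>3 w) = pure3 \<alpha>\<^sub>1 u \<alpha>\<^sub>2 v \<alpha>\<^sub>3 w"
proof -
  have "u \<otimes> (0 :: ('v, 'v) tensor) = 0"
    using tensor_pure_scale_right [of u 0 0] by simp
  then show ?thesis
    unfolding append_left_def pure2_def pure3_def
    by (subst linear_extend_single) auto
qed

section \<open>Families of operators\<close>

text \<open>A family \<open>X(a) \<in> \<Oplus>\<^bsub>\<alpha>\<in>s\<^sup>-\<^sup>1(a)\<^esub> End((V \<otimes> V)\<^sub>\<alpha>)\<close> is given by its components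
  \<open>X a \<alpha>\<close> with \<open>Src G \<alpha> = a\<close>; only their restrictions to \<open>(V \<otimes> V)\<^sub>\<alpha>\<close> matter. For \<open>V\<close> of finite
  type \<open>(V \<otimes> V)\<^sub>\<alpha> \<noteq> 0\<close> holds for only finitely many such \<open>\<alpha>\<close>, so that the direct sum is the
  direct product.\<close>

type_synonym ('o, 'g, 'v) op_family = "'o \<Rightarrow> 'g \<Rightarrow> ('g, 'v) tensor2 \<Rightarrow> ('g, 'v) tensor2"

definition graded_endo ::
    "('o, 'g) groupoid_data \<Rightarrow> ('g \<Rightarrow> 'v::complex_vector set) \<Rightarrow> ('o, 'g, 'v) op_family \<Rightarrow> bool"
  where "graded_endo G V X \<longleftrightarrow>
    (\<forall>a\<in>Obj G. \<forall>\<gamma>\<in>Arr G. Src G \<gamma> = a \<longrightarrow> linear_endo (graded_tensor2 G V \<gamma>) (X a \<gamma>))"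

definition graded_invertible ::
    "('o, 'g) groupoid_data \<Rightarrow> ('g \<Rightarrow> 'v::complex_vector set) \<Rightarrow> ('o, 'g, 'v) op_family \<Rightarrow> bool"
  where "graded_invertible G V X \<longleftrightarrow> (\<forall>a\<in>Obj G. \<forall>\<gamma>\<in>Arr G. Src G \<gamma> = a \<longrightarrow>
    bij_betw (X a \<gamma>) (graded_tensor2 G V \<gamma>) (graded_tensor2 G V \<gamma>))"

definition op_inverse ::
    "('o, 'g) groupoid_data \<Rightarrow> ('g \<Rightarrow> 'v::complex_vector set) \<Rightarrow>
      ('o, 'g, 'v) op_family \<Rightarrow> ('o, 'g, 'v) op_family"
  where "op_inverse G V X a \<gamma> = inv_into (graded_tensor2 G V \<gamma>) (X a \<gamma>)"

text \<open>The operators \<open>X\<^sup>(\<^sup>1\<^sup>2\<^sup>)(a)\<close> and \<open>X\<^sup>(\<^sup>2\<^sup>3\<^sup>)(ah\<^sup>(\<^sup>1\<^sup>))\<close> on \<open>(V \<otimes> V \<otimes> V)\<^sub>\<gamma>\<close>, where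
  \<open>Src G \<gamma> = a\<close>, are the linear operators with the prescribed values on \<open>u \<otimes> v \<otimes> w\<close>. To make them
  unique as functions they are set to zero outside \<open>(V \<otimes> V \<otimes> V)\<^sub>\<gamma>\<close>. They exist by
  \<open>op12_ex1\<close> and \<open>op23_ex1\<close> at the end of this theory.\<close>

definition is_op12 ::
    "('o, 'g) groupoid_data \<Rightarrow> ('g \<Rightarrow> 'v::complex_vector set) \<Rightarrow> ('o, 'g, 'v) op_family \<Rightarrow>
      'o \<Rightarrow> 'g \<Rightarrow> (('g, 'v) tensor3 \<Rightarrow> ('g, 'v) tensor3) \<Rightarrow> bool"
  where "is_op12 G V X a \<gamma> f \<longleftrightarrow>
    linear_endo (graded_tensor3 G V \<gamma>) f \<and> (\<forall>x. x \<notin> graded_tensor3 G V \<gamma> \<longrightarrow> f x = 0) \<and>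
    (\<forall>(\<alpha>\<^sub>1, \<alpha>\<^sub>2, \<alpha>\<^sub>3) \<in> comp_triples G \<gamma>. \<forall>u\<in>V \<alpha>\<^sub>1. \<forall>v\<in>V \<alpha>\<^sub>2. \<forall>w\<in>V \<alpha>\<^sub>3.
      f (pure3 \<alpha>\<^sub>1 u \<alpha>\<^sub>2 v \<alpha>\<^sub>3 w) = append_right (X a (Cmp G \<alpha>\<^sub>2 \<alpha>\<^sub>1) (pure2 \<alpha>\<^sub>1 u \<alpha>\<^sub>2 v)) \<alpha>\<^sub>3 w)"

definition is_op23 ::
    "('o, 'g) groupoid_data \<Rightarrow> ('g \<Rightarrow> 'v::complex_vector set) \<Rightarrow> ('o, 'g, 'v) op_family \<Rightarrow>
      'g \<Rightarrow> (('g, 'v) tensor3 \<Rightarrow> ('g, 'v) tensor3) \<Rightarrow> bool"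
  where "is_op23 G V X \<gamma> f \<longleftrightarrow>
    linear_endo (graded_tensor3 G V \<gamma>) f \<and> (\<forall>x. x \<notin> graded_tensor3 G V \<gamma> \<longrightarrow> f x = 0) \<and>
    (\<forall>(\<alpha>\<^sub>1, \<alpha>\<^sub>2, \<alpha>\<^sub>3) \<in> comp_triples G \<gamma>. \<forall>u\<in>V \<alpha>\<^sub>1. \<forall>v\<in>V \<alpha>\<^sub>2. \<forall>w\<in>V \<alpha>\<^sub>3.
      f (pure3 \<alpha>\<^sub>1 u \<alpha>\<^sub>2 v \<alpha>\<^sub>3 w)
        = append_left \<alpha>\<^sub>1 u (X (Tgt G \<alpha>\<^sub>1) (Cmp G \<alpha>\<^sub>3 \<alpha>\<^sub>2) (pure2 \<alpha>\<^sub>2 v \<alpha>\<^sub>3 w)))"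

definition op12 ::
    "('o, 'g) groupoid_data \<Rightarrow> ('g \<Rightarrow> 'v::complex_vector set) \<Rightarrow> ('o, 'g, 'v) op_family \<Rightarrow>
      'o \<Rightarrow> 'g \<Rightarrow> ('g, 'v) tensor3 \<Rightarrow> ('g, 'v) tensor3"
  where "op12 G V X a \<gamma> = (THE f. is_op12 G V X a \<gamma> f)"

definition op23 ::
    "('o, 'g) groupoid_data \<Rightarrow> ('g \<Rightarrow> 'v::complex_vector set) \<Rightarrow> ('o, 'g, 'v) op_family \<Rightarrow>
      'g \<Rightarrow> ('g, 'v) tensor3 \<Rightarrow> ('g, 'v) tensor3"
  where "op23 G V X \<gamma> = (THE f. is_op23 G V X \<gamma> f)"

text \<open>Multiplication by \<open>g(ah\<^sup>(\<^sup>1\<^sup>))\<close>.\<close>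

definition shifted_scalar ::
    "('o, 'g) groupoid_data \<Rightarrow> ('o \<Rightarrow> complex) \<Rightarrow> ('g, 'v::complex_vector) tensor3 \<Rightarrow> ('g, 'v) tensor3"
  where "shifted_scalar G g =
    Poly_Mapping.mapp (\<lambda>(\<alpha>\<^sub>1, _, _) z. g (Tgt G \<alpha>\<^sub>1) *\<^sub>C z)"

section \<open>Local dynamical Birman--Murakami--Wenzl operators\<close>

definition bmw_K ::
    "('o, 'g) groupoid_data \<Rightarrow> ('g \<Rightarrow> 'v::complex_vector set) \<Rightarrow> ('o \<Rightarrow> complex) \<Rightarrow>
      ('o, 'g, 'v) op_family \<Rightarrow> ('o, 'g, 'v) op_family"
  where "bmw_K G V q U a \<gamma> x =
    x - (1 / (q a - 1 / q a)) *\<^sub>C (U a \<gamma> x - op_inverse G V U a \<gamma> x)"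

definition op_sign_power ::
    "('o, 'g) groupoid_data \<Rightarrow> ('g \<Rightarrow> 'v::complex_vector set) \<Rightarrow>
      ('o, 'g, 'v) op_family \<Rightarrow> int \<Rightarrow> ('o, 'g, 'v) op_family"
  where "op_sign_power G V U \<epsilon> = (if \<epsilon> = 1 then U else op_inverse G V U)"

definition local_dynamical_BMW ::
    "('o, 'g) groupoid_data \<Rightarrow> ('g \<Rightarrow> 'v::complex_vector set) \<Rightarrow> ('o \<Rightarrow> complex) \<Rightarrow>
      ('o \<Rightarrow> complex) \<Rightarrow> ('o, 'g, 'v) op_family \<Rightarrow> bool"
  where "local_dynamical_BMW G V q \<nu> U \<longleftrightarrow>
    (\<forall>a\<in>Obj G. q a \<noteq> 1 / q a) \<and> graded_endo G V U \<and> graded_invertible G V U \<and>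
    (\<forall>a\<in>Obj G. \<forall>\<gamma>\<in>Arr G. Src G \<gamma> = a \<longrightarrow>
      (let K = bmw_K G V q U; U12 = op12 G V U a \<gamma>; U23 = op23 G V U \<gamma>;
           K12 = op12 G V K a \<gamma>; K23 = op23 G V K \<gamma>
       in
        (\<forall>x \<in> graded_tensor3 G V \<gamma>. U12 (U23 (U12 x)) = U23 (U12 (U23 x))) \<and>
        (\<forall>x \<in> graded_tensor2 G V \<gamma>.
          K a \<gamma> (U a \<gamma> x) = \<nu> a *\<^sub>C K a \<gamma> x \<and> U a \<gamma> (K a \<gamma> x) = \<nu> a *\<^sub>C K a \<gamma> x) \<and>
        (\<forall>\<epsilon>\<in>{1, -1}. \<forall>x \<in> graded_tensor3 G V \<gamma>.
          K23 (op12 G V (op_sign_power G V U \<epsilon>) a \<gamma> (K23 x))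
            = shifted_scalar G (\<lambda>b. \<nu> b powi (- \<epsilon>)) (K23 x)) \<and>
        (\<forall>\<epsilon>\<in>{1, -1}. \<forall>x \<in> graded_tensor3 G V \<gamma>.
          K12 (op23 G V (op_sign_power G V U \<epsilon>) \<gamma> (K12 x)) = \<nu> a powi (- \<epsilon>) *\<^sub>C K12 x)))"

definition R_check ::
    "('o, 'g) groupoid_data \<Rightarrow> ('g \<Rightarrow> 'v::complex_vector set) \<Rightarrow> ('o \<Rightarrow> complex) \<Rightarrow>
      ('o \<Rightarrow> complex) \<Rightarrow> ('o, 'g, 'v) op_family \<Rightarrow> complex \<Rightarrow> complex \<Rightarrow> ('o, 'g, 'v) op_family"
  where "R_check G V q \<nu> U u v a \<gamma> x =
    U a \<gamma> x + ((q a - 1 / q a) / (v / u - 1)) *\<^sub>C x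
      + ((q a - 1 / q a) / (1 + (1 / \<nu> a) * q a * (v / u))) *\<^sub>C bmw_K G V q U a \<gamma> x"

text \<open>The denominators of \<open>R_check u v\<close> at \<open>a\<close> do not vanish.\<close>

definition R_check_defined ::
    "('o \<Rightarrow> complex) \<Rightarrow> ('o \<Rightarrow> complex) \<Rightarrow> complex \<Rightarrow> complex \<Rightarrow> 'o \<Rightarrow> bool"
  where "R_check_defined q \<nu> u v a \<longleftrightarrow>
    u \<noteq> 0 \<and> v / u - 1 \<noteq> 0 \<and> 1 + (1 / \<nu> a) * q a * (v / u) \<noteq> 0"

section \<open>Existence and uniqueness of the operators \<open>op12\<close> and \<open>op23\<close>\<close>

lemma clinear_compose: "clinear f \<Longrightarrow> clinear g \<Longrightarrow> clinear (\<lambda>x. g (f x))"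
  by (rule clinearI) (simp_all add: clinear_add clinear_scale)

lemma clinear_sum: "(\<And>k. clinear (h k)) \<Longrightarrow> clinear (\<lambda>x. \<Sum>k\<in>A. h k x)"
  by (rule clinearI) (simp_all add: clinear_add clinear_scale sum.distrib cvec.scale_sum_right)

lemma clinear_single: "clinear (Poly_Mapping.single k :: 'v::complex_vector \<Rightarrow> _)"
  by (rule clinearI) (simp_all add: scaleC_single single_add)

lemma clinear_span:
  assumes "clinear f" "x \<in> cvec.span A" "\<And>y. y \<in> A \<Longrightarrow> f y \<in> cvec.span B"
  shows "f x \<in> cvec.span B"
  using assms(2)
  by (induction rule: cvec.span_induct_alt)
    (auto simp: clinear_zero clinear_add clinear_scale assms cvec.span_zero
      intro!: cvec.span_add cvec.span_scale)

lemma tensor_lift_add: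
  assumes f: "bilinear_map f" and g: "bilinear_map g" and h: "bilinear_map h"
    and eq: "\<And>u v. h u v = f u v + g u v"
  shows "tensor_lift h z = tensor_lift f z + tensor_lift g z"
proof -
  note t = tensor_universal [OF f] tensor_universal [OF g]
  have "(\<lambda>z. tensor_lift f z + tensor_lift g z) = tensor_lift h"
    by (rule tensor_universal(3) [OF h], rule clinearI)
      (simp_all add: clinear_add [OF t(1)] clinear_add [OF t(4)] clinear_scale [OF t(1)]
        clinear_scale [OF t(4)] t(2) t(5) eq scaleC_add_right)
  then show ?thesis
    by (rule fun_cong [OF sym])
qed

lemma tensor_lift_scale:
  assumes f: "bilinear_map f" and h: "bilinear_map h" and eq: "\<And>u v. h u v = c *\<^sub>C f u v"
  shows "tensor_lift h z = c *\<^sub>C tensor_lift f z"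
proof -
  note t = tensor_universal [OF f]
  have "(\<lambda>z. c *\<^sub>C tensor_lift f z) = tensor_lift h"
    by (rule tensor_universal(3) [OF h], rule clinearI)
      (simp_all add: clinear_add [OF t(1)] clinear_scale [OF t(1)] t(2) eq scaleC_add_right
        scaleC_scaleC mult.commute)
  then show ?thesis
    by (rule fun_cong [OF sym])
qed

lemma clinear_tensor_pure_right: "clinear ((\<otimes>) u)"
  and clinear_tensor_pure_left: "clinear (\<lambda>u. u \<otimes> v)"
  using bilinear_map_tensor_pure by (auto simp: bilinear_map_def)

lemma subspace_direct_sum:
  assumes "\<And>i. i \<in> I \<Longrightarrow> cvec.subspace (S i)"
  shows "cvec.subspace (direct_sum I S)"
proof (rule cvec.subspaceI)
  show "0 \<in> direct_sum I S"
    using assms by (auto simp: direct_sum_def cvec.subspace_0)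
  show "x + y \<in> direct_sum I S" if "x \<in> direct_sum I S" "y \<in> direct_sum I S" for x y
    using that Poly_Mapping.keys_add [of x y] assms
    by (auto simp: direct_sum_def lookup_add cvec.subspace_add)
  show "c *\<^sub>C x \<in> direct_sum I S" if "x \<in> direct_sum I S" for c x
  proof -
    have "Poly_Mapping.keys (c *\<^sub>C x) \<subseteq> Poly_Mapping.keys x"
      by (auto simp: in_keys_iff lookup_scaleC)
    then show ?thesis
      using that assms by (auto simp: direct_sum_def lookup_scaleC cvec.subspace_scale)
  qed
qed

lemma direct_sum_eq_span:
  assumes "\<And>i. i \<in> I \<Longrightarrow> S i = cvec.span (T i)"
  shows "direct_sum I S = cvec.span {Poly_Mapping.single i t | i t. i \<in> I \<and> t \<in> T i}"
    (is "_ = cvec.span ?A")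
proof
  have sub: "cvec.subspace (direct_sum I S)"
    by (rule subspace_direct_sum) (simp add: assms)
  have "?A \<subseteq> direct_sum I S"
    by (auto simp: direct_sum_def assms lookup_single when_def cvec.span_base cvec.span_zero
        split: if_splits)
  then show "cvec.span ?A \<subseteq> direct_sum I S"
    using sub by (rule cvec.span_minimal)
  show "direct_sum I S \<subseteq> cvec.span ?A"
  proof
    fix x assume x: "x \<in> direct_sum I S"
    have "x = (\<Sum>k\<in>Poly_Mapping.keys x. Poly_Mapping.single k (Poly_Mapping.lookup x k))"
      by (rule poly_mapping_eqI)
        (auto simp: lookup_sum lookup_single when_def in_keys_iff sum.If_cases)
    also have "\<dots> \<in> cvec.span ?A"
    proof (rule cvec.span_sum)
      fix k assume "k \<in> Poly_Mapping.keys x"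
      then have k: "k \<in> I" "Poly_Mapping.lookup x k \<in> cvec.span (T k)"
        using x assms by (auto simp: direct_sum_def)
      show "Poly_Mapping.single k (Poly_Mapping.lookup x k) \<in> cvec.span ?A"
        by (rule clinear_span [OF clinear_single k(2)]) (use k(1) in \<open>auto intro: cvec.span_base\<close>)
    qed
    finally show "x \<in> cvec.span ?A" .
  qed
qed

lemma graded_tensor2_eq_span:
  "graded_tensor2 G V \<gamma> = cvec.span {pure2 \<alpha> u \<beta> v | \<alpha> \<beta> u v.
    (\<alpha>, \<beta>) \<in> comp_pairs G \<gamma> \<and> u \<in> V \<alpha> \<and> v \<in> V \<beta>}"
proof -
  let ?T = "\<lambda>(\<alpha>, \<beta>). {u \<otimes> v | u v. u \<in> V \<alpha> \<and> v \<in> V \<beta>}"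
  have "graded_tensor2 G V \<gamma>
      = cvec.span {Poly_Mapping.single i t | i t. i \<in> comp_pairs G \<gamma> \<and> t \<in> ?T i}"
    unfolding graded_tensor2_def
    by (rule direct_sum_eq_span) (auto simp: tensor_space_def)
  also have "{Poly_Mapping.single i t | i t. i \<in> comp_pairs G \<gamma> \<and> t \<in> ?T i} =
    {pure2 \<alpha> u \<beta> v | \<alpha> \<beta> u v. (\<alpha>, \<beta>) \<in> comp_pairs G \<gamma> \<and> u \<in> V \<alpha> \<and> v \<in> V \<beta>}"
    (is "?A = ?B")
  proof (intro equalityI subsetI)
    fix x assume "x \<in> ?A"
    then obtain \<alpha> \<beta> u v where "x = Poly_Mapping.single (\<alpha>, \<beta>) (u \<otimes> v)"
      "(\<alpha>, \<beta>) \<in> comp_pairs G \<gamma>" "u \<in> V \<alpha>" "v \<in> V \<beta>"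
      by auto
    then show "x \<in> ?B"
      unfolding pure2_def by blast
  next
    fix x assume "x \<in> ?B"
    then obtain \<alpha> \<beta> u v where x: "x = Poly_Mapping.single (\<alpha>, \<beta>) (u \<otimes> v)"
      and k: "(\<alpha>, \<beta>) \<in> comp_pairs G \<gamma>" and uv: "u \<in> V \<alpha>" "v \<in> V \<beta>"
      unfolding pure2_def by blast
    have "u \<otimes> v \<in> ?T (\<alpha>, \<beta>)"
      unfolding prod.case using uv by blast
    then show "x \<in> ?A"
      using x k by blast
  qed
  finally show ?thesis .
qed

lemma tensor_space_tensor_space_eq_span:
  "tensor_space S (tensor_space T W)
    = cvec.span {u \<otimes> v \<otimes> w | u v w. u \<in> S \<and> v \<in> T \<and> w \<in> W}" (is "_ = cvec.span ?A")
proof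
  have pure: "u \<otimes> y \<in> cvec.span ?A" if u: "u \<in> S" and y: "y \<in> tensor_space T W" for u y
  proof (rule clinear_span [OF clinear_tensor_pure_right])
    show "y \<in> cvec.span {v \<otimes> w | v w. v \<in> T \<and> w \<in> W}"
      using y by (simp only: tensor_space_def)
    show "u \<otimes> z \<in> cvec.span ?A" if "z \<in> {v \<otimes> w | v w. v \<in> T \<and> w \<in> W}" for z
    proof (rule cvec.span_base)
      show "u \<otimes> z \<in> ?A"
        using u that by blast
    qed
  qed
  have "{u \<otimes> y | u y. u \<in> S \<and> y \<in> tensor_space T W} \<subseteq> cvec.span ?A"
    using pure by blast
  then show "tensor_space S (tensor_space T W) \<subseteq> cvec.span ?A"
    unfolding tensor_space_def [of S] by (rule cvec.span_minimal) (rule cvec.subspace_span)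
  have pure': "v \<otimes> w \<in> tensor_space T W" if "v \<in> T" "w \<in> W" for v w
    unfolding tensor_space_def by (rule cvec.span_base) (use that in blast)
  have "?A \<subseteq> {u \<otimes> y | u y. u \<in> S \<and> y \<in> tensor_space T W}"
    using pure' by blast
  then show "cvec.span ?A \<subseteq> tensor_space S (tensor_space T W)"
    unfolding tensor_space_def [of S] by (rule cvec.span_mono)
qed

lemma graded_tensor3_eq_span:
  "graded_tensor3 G V \<gamma> = cvec.span {pure3 \<alpha>\<^sub>1 u \<alpha>\<^sub>2 v \<alpha>\<^sub>3 w | \<alpha>\<^sub>1 \<alpha>\<^sub>2 \<alpha>\<^sub>3 u v w.
    (\<alpha>\<^sub>1, \<alpha>\<^sub>2, \<alpha>\<^sub>3) \<in> comp_triples G \<gamma> \<and> u \<in> V \<alpha>\<^sub>1 \<and> v \<in> V \<alpha>\<^sub>2 \<and> w \<in> V \<alpha>\<^sub>3}"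
proof -
  let ?T = "\<lambda>(\<alpha>\<^sub>1, \<alpha>\<^sub>2, \<alpha>\<^sub>3). {u \<otimes> v \<otimes> w | u v w. u \<in> V \<alpha>\<^sub>1 \<and> v \<in> V \<alpha>\<^sub>2 \<and> w \<in> V \<alpha>\<^sub>3}"
  have "graded_tensor3 G V \<gamma>
      = cvec.span {Poly_Mapping.single i t | i t. i \<in> comp_triples G \<gamma> \<and> t \<in> ?T i}"
    unfolding graded_tensor3_def
    by (rule direct_sum_eq_span) (auto simp: tensor_space_tensor_space_eq_span)
  also have "{Poly_Mapping.single i t | i t. i \<in> comp_triples G \<gamma> \<and> t \<in> ?T i} =
    {pure3 \<alpha>\<^sub>1 u \<alpha>\<^sub>2 v \<alpha>\<^sub>3 w | \<alpha>\<^sub>1 \<alpha>\<^sub>2 \<alpha>\<^sub>3 u v w.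
      (\<alpha>\<^sub>1, \<alpha>\<^sub>2, \<alpha>\<^sub>3) \<in> comp_triples G \<gamma> \<and> u \<in> V \<alpha>\<^sub>1 \<and> v \<in> V \<alpha>\<^sub>2 \<and> w \<in> V \<alpha>\<^sub>3}"
    (is "?A = ?B")
  proof (intro equalityI subsetI)
    fix x assume "x \<in> ?A"
    then obtain \<alpha>\<^sub>1 \<alpha>\<^sub>2 \<alpha>\<^sub>3 u v w where "x = Poly_Mapping.single (\<alpha>\<^sub>1, \<alpha>\<^sub>2, \<alpha>\<^sub>3) (u \<otimes> v \<otimes> w)"
      "(\<alpha>\<^sub>1, \<alpha>\<^sub>2, \<alpha>\<^sub>3) \<in> comp_triples G \<gamma>" "u \<in> V \<alpha>\<^sub>1" "v \<in> V \<alpha>\<^sub>2" "w \<in> V \<alpha>\<^sub>3"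
      by auto
    then show "x \<in> ?B"
      unfolding pure3_def by blast
  next
    fix x assume "x \<in> ?B"
    then obtain \<alpha>\<^sub>1 \<alpha>\<^sub>2 \<alpha>\<^sub>3 u v w where x: "x = Poly_Mapping.single (\<alpha>\<^sub>1, \<alpha>\<^sub>2, \<alpha>\<^sub>3) (u \<otimes> v \<otimes> w)"
      and k: "(\<alpha>\<^sub>1, \<alpha>\<^sub>2, \<alpha>\<^sub>3) \<in> comp_triples G \<gamma>" and uvw: "u \<in> V \<alpha>\<^sub>1" "v \<in> V \<alpha>\<^sub>2" "w \<in> V \<alpha>\<^sub>3"
      unfolding pure3_def by blast
    have "u \<otimes> v \<otimes> w \<in> ?T (\<alpha>\<^sub>1, \<alpha>\<^sub>2, \<alpha>\<^sub>3)"
      unfolding prod.case using uvw by blast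
    then show "x \<in> ?A"
      using x k by blast
  qed
  finally show ?thesis .
qed

lemma subspace_graded_tensor2: "cvec.subspace (graded_tensor2 G V \<gamma>)"
  and subspace_graded_tensor3: "cvec.subspace (graded_tensor3 G V \<gamma>)"
  by (simp_all add: graded_tensor2_eq_span graded_tensor3_eq_span)

lemma linear_endo_eq_on_span:
  assumes f: "linear_endo (cvec.span A) f" and g: "linear_endo (cvec.span A) g"
    and eq: "\<And>y. y \<in> A \<Longrightarrow> f y = g y" and x: "x \<in> cvec.span A"
  shows "f x = g x"
proof -
  have zero: "h 0 = 0" if h: "linear_endo (cvec.span A) h" for h
  proof -
    have "h (0 *\<^sub>C 0) = 0 *\<^sub>C h 0"
      using h cvec.span_zero unfolding linear_endo_def by blast
    then show ?thesis
      by simp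
  qed
  have "cvec.subspace {x \<in> cvec.span A. f x = g x}"
    using f g zero [OF f] zero [OF g]
    by (intro cvec.subspaceI) (auto simp: linear_endo_def cvec.span_zero cvec.span_add cvec.span_scale)
  moreover have "A \<subseteq> {x \<in> cvec.span A. f x = g x}"
    using eq cvec.span_superset by auto
  ultimately have "cvec.span A \<subseteq> {x \<in> cvec.span A. f x = g x}"
    by (intro cvec.span_minimal)
  then show ?thesis
    using x by auto
qed

lemma pure3_ex1:
  fixes T :: "'g \<times> 'g \<times> 'g \<Rightarrow> 'v::complex_vector \<Rightarrow> 'v \<Rightarrow> 'v \<Rightarrow> ('g, 'v) tensor3"
  assumes lin: "\<And>k u v. clinear (\<lambda>w. T k u v w)" "\<And>k u w. clinear (\<lambda>v. T k u v w)"
      "\<And>k v w. clinear (\<lambda>u. T k u v w)"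
    and into: "\<And>\<alpha>\<^sub>1 \<alpha>\<^sub>2 \<alpha>\<^sub>3 u v w. \<lbrakk>(\<alpha>\<^sub>1, \<alpha>\<^sub>2, \<alpha>\<^sub>3) \<in> comp_triples G \<gamma>; u \<in> V \<alpha>\<^sub>1; v \<in> V \<alpha>\<^sub>2; w \<in> V \<alpha>\<^sub>3\<rbrakk>
      \<Longrightarrow> T (\<alpha>\<^sub>1, \<alpha>\<^sub>2, \<alpha>\<^sub>3) u v w \<in> graded_tensor3 G V \<gamma>"
  shows "\<exists>!f. linear_endo (graded_tensor3 G V \<gamma>) f \<and> (\<forall>x. x \<notin> graded_tensor3 G V \<gamma> \<longrightarrow> f x = 0) \<and>
    (\<forall>(\<alpha>\<^sub>1, \<alpha>\<^sub>2, \<alpha>\<^sub>3) \<in> comp_triples G \<gamma>. \<forall>u\<in>V \<alpha>\<^sub>1. \<forall>v\<in>V \<alpha>\<^sub>2. \<forall>w\<in>V \<alpha>\<^sub>3.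
      f (pure3 \<alpha>\<^sub>1 u \<alpha>\<^sub>2 v \<alpha>\<^sub>3 w) = T (\<alpha>\<^sub>1, \<alpha>\<^sub>2, \<alpha>\<^sub>3) u v w)" (is "\<exists>!f. ?P f")
proof (rule ex_ex1I)
  let ?S = "graded_tensor3 G V \<gamma>"
  let ?A = "{pure3 \<alpha>\<^sub>1 u \<alpha>\<^sub>2 v \<alpha>\<^sub>3 w | \<alpha>\<^sub>1 \<alpha>\<^sub>2 \<alpha>\<^sub>3 u v w.
    (\<alpha>\<^sub>1, \<alpha>\<^sub>2, \<alpha>\<^sub>3) \<in> comp_triples G \<gamma> \<and> u \<in> V \<alpha>\<^sub>1 \<and> v \<in> V \<alpha>\<^sub>2 \<and> w \<in> V \<alpha>\<^sub>3}"
  have T_add: "T k u v (w + w') = T k u v w + T k u v w'"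
    "T k u (v + v') w = T k u v w + T k u v' w" "T k (u + u') v w = T k u v w + T k u' v w"
    for k u v w u' v' w'
    using clinear_add [OF lin(1) [of k u v], of w w'] clinear_add [OF lin(2) [of k u w], of v v']
      clinear_add [OF lin(3) [of k v w], of u u']
    by simp_all
  have T_scale: "T k u v (c *\<^sub>C w) = c *\<^sub>C T k u v w"
    "T k u (c *\<^sub>C v) w = c *\<^sub>C T k u v w" "T k (c *\<^sub>C u) v w = c *\<^sub>C T k u v w"
    for k u v w c
    using clinear_scale [OF lin(1) [of k u v], of c w] clinear_scale [OF lin(2) [of k u w], of c v]
      clinear_scale [OF lin(3) [of k v w], of c u]
    by simp_all
  have b1: "bilinear_map (T k u)" for k u
    by (simp add: bilinear_map_def lin)
  note t1 = tensor_universal [OF b1]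
  have lin_u: "clinear (\<lambda>u. tensor_lift (T k u) z)" for k z
    by (intro clinearI tensor_lift_add tensor_lift_scale b1) (simp_all add: T_add T_scale)
  have b2: "bilinear_map (\<lambda>u. tensor_lift (T k u))" for k
    by (simp add: bilinear_map_def t1(1) lin_u)
  note t2 = tensor_universal [OF b2]
  define f0 where "f0 = linear_extend (\<lambda>k. tensor_lift (\<lambda>u. tensor_lift (T k u)))"
  have f0: "clinear f0"
    unfolding f0_def by (rule clinear_linear_extend) (rule t2(1))
  have f0_pure: "f0 (pure3 \<alpha>\<^sub>1 u \<alpha>\<^sub>2 v \<alpha>\<^sub>3 w) = T (\<alpha>\<^sub>1, \<alpha>\<^sub>2, \<alpha>\<^sub>3) u v w" for \<alpha>\<^sub>1 \<alpha>\<^sub>2 \<alpha>\<^sub>3 u v w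
    unfolding f0_def pure3_def
    by (subst linear_extend_single) (simp_all add: clinear_zero [OF t2(1)] t2(2) t1(2))
  have f0_into: "f0 x \<in> ?S" if "x \<in> ?S" for x
  proof -
    have "f0 y \<in> cvec.span ?A" if y: "y \<in> ?A" for y
    proof -
      obtain \<alpha>\<^sub>1 \<alpha>\<^sub>2 \<alpha>\<^sub>3 u v w where y: "y = pure3 \<alpha>\<^sub>1 u \<alpha>\<^sub>2 v \<alpha>\<^sub>3 w"
        "(\<alpha>\<^sub>1, \<alpha>\<^sub>2, \<alpha>\<^sub>3) \<in> comp_triples G \<gamma>" "u \<in> V \<alpha>\<^sub>1" "v \<in> V \<alpha>\<^sub>2" "w \<in> V \<alpha>\<^sub>3"
        using y by blast
      show ?thesis
        using into [OF y(2-5)] by (simp only: y(1) f0_pure graded_tensor3_eq_span)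
    qed
    then show ?thesis
      using clinear_span [OF f0] that unfolding graded_tensor3_eq_span by blast
  qed
  have A_S: "?A \<subseteq> ?S"
    unfolding graded_tensor3_eq_span by (rule cvec.span_superset)
  define f where "f = (\<lambda>x. if x \<in> ?S then f0 x else 0)"
  have "linear_endo ?S f"
    by (simp add: linear_endo_def f_def f0_into clinear_add [OF f0] clinear_scale [OF f0]
        cvec.subspace_add [OF subspace_graded_tensor3]
        cvec.subspace_scale [OF subspace_graded_tensor3])
  moreover have "pure3 \<alpha>\<^sub>1 u \<alpha>\<^sub>2 v \<alpha>\<^sub>3 w \<in> ?S"
    if "(\<alpha>\<^sub>1, \<alpha>\<^sub>2, \<alpha>\<^sub>3) \<in> comp_triples G \<gamma>" "u \<in> V \<alpha>\<^sub>1" "v \<in> V \<alpha>\<^sub>2" "w \<in> V \<alpha>\<^sub>3" for \<alpha>\<^sub>1 \<alpha>\<^sub>2 \<alpha>\<^sub>3 u v w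
    using A_S that by blast
  ultimately have "?P f"
    by (simp add: f_def f0_pure split_beta)
  then show "\<exists>f. ?P f"
    by (rule exI [of ?P f])
  show "f = g" if f: "?P f" and g: "?P g" for f g
  proof
    fix x
    show "f x = g x"
    proof (cases "x \<in> ?S")
      case True
      show ?thesis
      proof (rule linear_endo_eq_on_span [of ?A f g x])
        show "linear_endo (cvec.span ?A) f" "linear_endo (cvec.span ?A) g" "x \<in> cvec.span ?A"
          using f g True unfolding graded_tensor3_eq_span by blast+
        show "f y = g y" if y: "y \<in> ?A" for y
        proof -
          obtain \<alpha>\<^sub>1 \<alpha>\<^sub>2 \<alpha>\<^sub>3 u v w where y: "y = pure3 \<alpha>\<^sub>1 u \<alpha>\<^sub>2 v \<alpha>\<^sub>3 w"
            "(\<alpha>\<^sub>1, \<alpha>\<^sub>2, \<alpha>\<^sub>3) \<in> comp_triples G \<gamma>" "u \<in> V \<alpha>\<^sub>1" "v \<in> V \<alpha>\<^sub>2" "w \<in> V \<alpha>\<^sub>3"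
            using y by blast
          have "h y = T (\<alpha>\<^sub>1, \<alpha>\<^sub>2, \<alpha>\<^sub>3) u v w" if "?P h" for h
            using that [THEN conjunct2, THEN conjunct2, THEN bspec, OF y(2)] y(3-5)
            unfolding y(1) prod.case by blast
          from this [OF f] this [OF g] show ?thesis
            by simp
        qed
      qed
    next
      case False
      then show ?thesis
        using f g by simp
    qed
  qed
qed

lemma linear_endo_extend:
  assumes S: "cvec.subspace S" and f: "linear_endo S f"
  obtains g where "clinear g" "\<And>x. x \<in> S \<Longrightarrow> g x = f x" "\<And>x. g x \<in> S"
proof -
  obtain p where p: "range p \<subseteq> S" "clinear p" "\<And>x. x \<in> S \<Longrightarrow> p x = x"
    using vector_space_pair.linear_exists_left_inverse_on [OF _ cvec.linear_id S]
    by (auto simp: vector_space_pair_def cvec.vector_space_axioms)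
  show thesis
  proof (rule that [of "\<lambda>x. f (p x)"])
    show "clinear (\<lambda>x. f (p x))"
      using p f by (intro clinearI)
        (auto simp: linear_endo_def clinear_add clinear_scale image_subset_iff)
  qed (use p f in \<open>auto simp: linear_endo_def image_subset_iff\<close>)
qed

lemma
  fixes y :: "('g, 'v::complex_vector) tensor2" and w :: 'v
  shows clinear_append_right: "clinear (\<lambda>y. append_right y \<alpha> w)" (is ?th1)
    and clinear_append_right': "clinear (append_right y \<alpha>)" (is ?th2)
proof -
  have f: "bilinear_map (\<lambda>u v. u \<otimes> v \<otimes> w)" for w :: 'v
    unfolding bilinear_map_def
    by (auto intro!: clinearI simp: tensor_pure_add_left tensor_pure_add_right
        tensor_pure_scale_left tensor_pure_scale_right)
  note t = tensor_universal [OF f]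
  show ?th1
    unfolding append_right_def
    by (rule clinear_linear_extend)
      (auto intro!: clinear_compose [OF t(1) clinear_single])
  have lift: "clinear (\<lambda>w :: 'v. tensor_lift (\<lambda>u v. u \<otimes> v \<otimes> w) z)" for z
    by (intro clinearI tensor_lift_add tensor_lift_scale f)
      (simp_all add: tensor_pure_add_right tensor_pure_scale_right)
  show ?th2
    unfolding append_right_def linear_extend_def case_prod_unfold
    by (intro clinear_sum clinear_compose [OF lift clinear_single])
qed

lemma clinear_append_left: "clinear (append_left \<alpha> u)" (is ?th1)
  and clinear_append_left': "clinear (\<lambda>u. append_left \<alpha> u y)" (is ?th2)
proof -
  show ?th1
    unfolding append_left_def
    by (rule clinear_linear_extend)
      (auto intro!: clinear_compose [OF clinear_tensor_pure_right clinear_single])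
  show ?th2
    unfolding append_left_def linear_extend_def case_prod_unfold
    by (intro clinear_sum clinear_compose [OF clinear_tensor_pure_left clinear_single])
qed

lemma clinear_pure2: "clinear (pure2 \<alpha> u \<beta>)" (is ?th1)
  and clinear_pure2': "clinear (\<lambda>u. pure2 \<alpha> u \<beta> v)" (is ?th2)
  unfolding pure2_def
  by (intro clinear_compose [OF clinear_tensor_pure_right clinear_single]
      clinear_compose [OF clinear_tensor_pure_left clinear_single])+

context groupoid
begin

lemma append_right_in:
  assumes "(\<alpha>\<^sub>1, \<alpha>\<^sub>2, \<alpha>\<^sub>3) \<in> comp_triples G \<gamma>" "y \<in> graded_tensor2 G V (Cmp G \<alpha>\<^sub>2 \<alpha>\<^sub>1)" "w \<in> V \<alpha>\<^sub>3"
  shows "append_right y \<alpha>\<^sub>3 w \<in> graded_tensor3 G V \<gamma>"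
  unfolding graded_tensor3_eq_span
proof (rule clinear_span [OF clinear_append_right])
  show "y \<in> cvec.span {pure2 \<alpha> u \<beta> v | \<alpha> \<beta> u v.
      (\<alpha>, \<beta>) \<in> comp_pairs G (Cmp G \<alpha>\<^sub>2 \<alpha>\<^sub>1) \<and> u \<in> V \<alpha> \<and> v \<in> V \<beta>}"
    using assms(2) by (simp add: graded_tensor2_eq_span)
  have *: "(\<alpha>, \<beta>, \<alpha>\<^sub>3) \<in> comp_triples G \<gamma>" if "(\<alpha>, \<beta>) \<in> comp_pairs G (Cmp G \<alpha>\<^sub>2 \<alpha>\<^sub>1)" for \<alpha> \<beta>
    using that assms(1) Tgt_Cmp [of \<alpha> \<beta>] Tgt_Cmp [of \<alpha>\<^sub>1 \<alpha>\<^sub>2]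
    by (auto simp: comp_triples_def comp_pairs_def)
  show "append_right z \<alpha>\<^sub>3 w \<in> cvec.span {pure3 \<alpha>\<^sub>1 u \<alpha>\<^sub>2 v \<alpha>\<^sub>3 w | \<alpha>\<^sub>1 \<alpha>\<^sub>2 \<alpha>\<^sub>3 u v w.
      (\<alpha>\<^sub>1, \<alpha>\<^sub>2, \<alpha>\<^sub>3) \<in> comp_triples G \<gamma> \<and> u \<in> V \<alpha>\<^sub>1 \<and> v \<in> V \<alpha>\<^sub>2 \<and> w \<in> V \<alpha>\<^sub>3}"
    if "z \<in> {pure2 \<alpha> u \<beta> v | \<alpha> \<beta> u v.
      (\<alpha>, \<beta>) \<in> comp_pairs G (Cmp G \<alpha>\<^sub>2 \<alpha>\<^sub>1) \<and> u \<in> V \<alpha> \<and> v \<in> V \<beta>}" for z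
    using that assms(3) by (auto simp: append_right_pure2 intro!: cvec.span_base) (use * in blast)
qed

lemma append_left_in:
  assumes "(\<alpha>\<^sub>1, \<alpha>\<^sub>2, \<alpha>\<^sub>3) \<in> comp_triples G \<gamma>" "y \<in> graded_tensor2 G V (Cmp G \<alpha>\<^sub>3 \<alpha>\<^sub>2)" "u \<in> V \<alpha>\<^sub>1"
  shows "append_left \<alpha>\<^sub>1 u y \<in> graded_tensor3 G V \<gamma>"
  unfolding graded_tensor3_eq_span
proof (rule clinear_span [OF clinear_append_left])
  show "y \<in> cvec.span {pure2 \<alpha> u \<beta> v | \<alpha> \<beta> u v.
      (\<alpha>, \<beta>) \<in> comp_pairs G (Cmp G \<alpha>\<^sub>3 \<alpha>\<^sub>2) \<and> u \<in> V \<alpha> \<and> v \<in> V \<beta>}"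
    using assms(2) by (simp add: graded_tensor2_eq_span)
  have *: "(\<alpha>\<^sub>1, \<alpha>, \<beta>) \<in> comp_triples G \<gamma>" if "(\<alpha>, \<beta>) \<in> comp_pairs G (Cmp G \<alpha>\<^sub>3 \<alpha>\<^sub>2)" for \<alpha> \<beta>
    using that assms(1) Src_Cmp [of \<alpha> \<beta>] Src_Cmp [of \<alpha>\<^sub>2 \<alpha>\<^sub>3] Cmp_assoc [of \<alpha>\<^sub>1 \<alpha> \<beta>]
      Cmp_assoc [of \<alpha>\<^sub>1 \<alpha>\<^sub>2 \<alpha>\<^sub>3]
    by (auto simp: comp_triples_def comp_pairs_def)
  show "append_left \<alpha>\<^sub>1 u z \<in> cvec.span {pure3 \<alpha>\<^sub>1 u \<alpha>\<^sub>2 v \<alpha>\<^sub>3 w | \<alpha>\<^sub>1 \<alpha>\<^sub>2 \<alpha>\<^sub>3 u v w.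
      (\<alpha>\<^sub>1, \<alpha>\<^sub>2, \<alpha>\<^sub>3) \<in> comp_triples G \<gamma> \<and> u \<in> V \<alpha>\<^sub>1 \<and> v \<in> V \<alpha>\<^sub>2 \<and> w \<in> V \<alpha>\<^sub>3}"
    if "z \<in> {pure2 \<alpha> u \<beta> v | \<alpha> \<beta> u v.
      (\<alpha>, \<beta>) \<in> comp_pairs G (Cmp G \<alpha>\<^sub>3 \<alpha>\<^sub>2) \<and> u \<in> V \<alpha> \<and> v \<in> V \<beta>}" for z
    using that assms(3) by (auto simp: append_left_pure2 intro!: cvec.span_base) (use * in blast)
qed

lemma pure2_in:
  assumes "\<alpha> \<in> Arr G" "\<beta> \<in> Arr G" "Tgt G \<alpha> = Src G \<beta>" "u \<in> V \<alpha>" "v \<in> V \<beta>"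
  shows "pure2 \<alpha> u \<beta> v \<in> graded_tensor2 G V (Cmp G \<beta> \<alpha>)"
  unfolding graded_tensor2_eq_span
  by (rule cvec.span_base) (use assms in \<open>auto simp: comp_pairs_def\<close>)

lemma op12_ex1:
  assumes X: "graded_endo G V X" and \<gamma>: "Src G \<gamma> = a"
  shows "\<exists>!f. is_op12 G V X a \<gamma> f"
proof -
  have "\<exists>g. clinear g \<and> (\<forall>x. g x \<in> graded_tensor2 G V \<delta>) \<and>
      (\<delta> \<in> Arr G \<and> Src G \<delta> = a \<longrightarrow> (\<forall>x \<in> graded_tensor2 G V \<delta>. g x = X a \<delta> x))" for \<delta>
  proof (cases "\<delta> \<in> Arr G \<and> Src G \<delta> = a")
    case True
    then have "linear_endo (graded_tensor2 G V \<delta>) (X a \<delta>)"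
      using X Src_Obj by (auto simp: graded_endo_def)
    then show ?thesis
      by (rule linear_endo_extend [OF subspace_graded_tensor2]) auto
  next
    case False
    then show ?thesis
      using cvec.subspace_0 [OF subspace_graded_tensor2]
      by (intro exI [of _ "\<lambda>_. 0"]) (auto intro!: clinearI)
  qed
  then obtain Y where Y: "clinear (Y \<delta>)" "Y \<delta> x \<in> graded_tensor2 G V \<delta>"
    "\<lbrakk>\<delta> \<in> Arr G; Src G \<delta> = a; x \<in> graded_tensor2 G V \<delta>\<rbrakk> \<Longrightarrow> Y \<delta> x = X a \<delta> x" for \<delta> x
    by metis
  define T where "T = (\<lambda>(\<alpha>\<^sub>1, \<alpha>\<^sub>2, \<alpha>\<^sub>3) u v w.
    append_right (Y (Cmp G \<alpha>\<^sub>2 \<alpha>\<^sub>1) (pure2 \<alpha>\<^sub>1 u \<alpha>\<^sub>2 v)) \<alpha>\<^sub>3 w)"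
  have T: "T (\<alpha>\<^sub>1, \<alpha>\<^sub>2, \<alpha>\<^sub>3) u v w
      = append_right (X a (Cmp G \<alpha>\<^sub>2 \<alpha>\<^sub>1) (pure2 \<alpha>\<^sub>1 u \<alpha>\<^sub>2 v)) \<alpha>\<^sub>3 w"
    if "(\<alpha>\<^sub>1, \<alpha>\<^sub>2, \<alpha>\<^sub>3) \<in> comp_triples G \<gamma>" "u \<in> V \<alpha>\<^sub>1" "v \<in> V \<alpha>\<^sub>2" "w \<in> V \<alpha>\<^sub>3" for \<alpha>\<^sub>1 \<alpha>\<^sub>2 \<alpha>\<^sub>3 u v w
    unfolding T_def using that \<gamma>
    by (auto simp: comp_triples_def pure2_in Src_Cmp Tgt_Cmp Cmp_Arr Y(3))
  have "\<exists>!f. linear_endo (graded_tensor3 G V \<gamma>) f \<and> (\<forall>x. x \<notin> graded_tensor3 G V \<gamma> \<longrightarrow> f x = 0) \<and>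
    (\<forall>(\<alpha>\<^sub>1, \<alpha>\<^sub>2, \<alpha>\<^sub>3) \<in> comp_triples G \<gamma>. \<forall>u\<in>V \<alpha>\<^sub>1. \<forall>v\<in>V \<alpha>\<^sub>2. \<forall>w\<in>V \<alpha>\<^sub>3.
      f (pure3 \<alpha>\<^sub>1 u \<alpha>\<^sub>2 v \<alpha>\<^sub>3 w) = T (\<alpha>\<^sub>1, \<alpha>\<^sub>2, \<alpha>\<^sub>3) u v w)"
  proof (rule pure3_ex1)
    fix k :: "'g \<times> 'g \<times> 'g" and u v w
    obtain \<alpha>\<^sub>1 \<alpha>\<^sub>2 \<alpha>\<^sub>3 where k: "k = (\<alpha>\<^sub>1, \<alpha>\<^sub>2, \<alpha>\<^sub>3)"
      by (cases k)
    show "clinear (\<lambda>w. T k u v w)"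
      by (simp add: k T_def clinear_append_right')
    show "clinear (\<lambda>v. T k u v w)"
      unfolding k T_def prod.case
      by (rule clinear_compose [OF clinear_compose [OF clinear_pure2 Y(1)] clinear_append_right])
    show "clinear (\<lambda>u. T k u v w)"
      unfolding k T_def prod.case
      by (rule clinear_compose [OF clinear_compose [OF clinear_pure2' Y(1)] clinear_append_right])
  next
    show "T (\<alpha>\<^sub>1, \<alpha>\<^sub>2, \<alpha>\<^sub>3) u v w \<in> graded_tensor3 G V \<gamma>"
      if "(\<alpha>\<^sub>1, \<alpha>\<^sub>2, \<alpha>\<^sub>3) \<in> comp_triples G \<gamma>" "w \<in> V \<alpha>\<^sub>3" for \<alpha>\<^sub>1 \<alpha>\<^sub>2 \<alpha>\<^sub>3 u v w
      unfolding T_def prod.case by (rule append_right_in [OF that(1) Y(2) that(2)])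
  qed
  moreover have "(\<forall>(\<alpha>\<^sub>1, \<alpha>\<^sub>2, \<alpha>\<^sub>3) \<in> comp_triples G \<gamma>. \<forall>u\<in>V \<alpha>\<^sub>1. \<forall>v\<in>V \<alpha>\<^sub>2. \<forall>w\<in>V \<alpha>\<^sub>3.
      f (pure3 \<alpha>\<^sub>1 u \<alpha>\<^sub>2 v \<alpha>\<^sub>3 w) = T (\<alpha>\<^sub>1, \<alpha>\<^sub>2, \<alpha>\<^sub>3) u v w) \<longleftrightarrow>
    (\<forall>(\<alpha>\<^sub>1, \<alpha>\<^sub>2, \<alpha>\<^sub>3) \<in> comp_triples G \<gamma>. \<forall>u\<in>V \<alpha>\<^sub>1. \<forall>v\<in>V \<alpha>\<^sub>2. \<forall>w\<in>V \<alpha>\<^sub>3.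
      f (pure3 \<alpha>\<^sub>1 u \<alpha>\<^sub>2 v \<alpha>\<^sub>3 w) = append_right (X a (Cmp G \<alpha>\<^sub>2 \<alpha>\<^sub>1) (pure2 \<alpha>\<^sub>1 u \<alpha>\<^sub>2 v)) \<alpha>\<^sub>3 w)" for f
    by (auto simp: T)
  ultimately show ?thesis
    unfolding is_op12_def by simp
qed

lemma op23_ex1:
  assumes X: "graded_endo G V X"
  shows "\<exists>!f. is_op23 G V X \<gamma> f"
proof -
  have "\<exists>g. clinear g \<and> (\<forall>x. g x \<in> graded_tensor2 G V \<delta>) \<and>
      (\<delta> \<in> Arr G \<longrightarrow> (\<forall>x \<in> graded_tensor2 G V \<delta>. g x = X (Src G \<delta>) \<delta> x))" for \<delta>
  proof (cases "\<delta> \<in> Arr G")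
    case True
    then have "linear_endo (graded_tensor2 G V \<delta>) (X (Src G \<delta>) \<delta>)"
      using X Src_Obj by (auto simp: graded_endo_def)
    then show ?thesis
      by (rule linear_endo_extend [OF subspace_graded_tensor2]) auto
  next
    case False
    then show ?thesis
      using cvec.subspace_0 [OF subspace_graded_tensor2]
      by (intro exI [of _ "\<lambda>_. 0"]) (auto intro!: clinearI)
  qed
  then obtain Y where Y: "clinear (Y \<delta>)" "Y \<delta> x \<in> graded_tensor2 G V \<delta>"
    "\<lbrakk>\<delta> \<in> Arr G; x \<in> graded_tensor2 G V \<delta>\<rbrakk> \<Longrightarrow> Y \<delta> x = X (Src G \<delta>) \<delta> x" for \<delta> x
    by metis
  define T where "T = (\<lambda>(\<alpha>\<^sub>1, \<alpha>\<^sub>2, \<alpha>\<^sub>3) u v w.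
    append_left \<alpha>\<^sub>1 u (Y (Cmp G \<alpha>\<^sub>3 \<alpha>\<^sub>2) (pure2 \<alpha>\<^sub>2 v \<alpha>\<^sub>3 w)))"
  have T: "T (\<alpha>\<^sub>1, \<alpha>\<^sub>2, \<alpha>\<^sub>3) u v w
      = append_left \<alpha>\<^sub>1 u (X (Tgt G \<alpha>\<^sub>1) (Cmp G \<alpha>\<^sub>3 \<alpha>\<^sub>2) (pure2 \<alpha>\<^sub>2 v \<alpha>\<^sub>3 w))"
    if "(\<alpha>\<^sub>1, \<alpha>\<^sub>2, \<alpha>\<^sub>3) \<in> comp_triples G \<gamma>" "u \<in> V \<alpha>\<^sub>1" "v \<in> V \<alpha>\<^sub>2" "w \<in> V \<alpha>\<^sub>3" for \<alpha>\<^sub>1 \<alpha>\<^sub>2 \<alpha>\<^sub>3 u v w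
    unfolding T_def using that
    by (auto simp: comp_triples_def pure2_in Src_Cmp Tgt_Cmp Cmp_Arr Y(3))
  have "\<exists>!f. linear_endo (graded_tensor3 G V \<gamma>) f \<and> (\<forall>x. x \<notin> graded_tensor3 G V \<gamma> \<longrightarrow> f x = 0) \<and>
    (\<forall>(\<alpha>\<^sub>1, \<alpha>\<^sub>2, \<alpha>\<^sub>3) \<in> comp_triples G \<gamma>. \<forall>u\<in>V \<alpha>\<^sub>1. \<forall>v\<in>V \<alpha>\<^sub>2. \<forall>w\<in>V \<alpha>\<^sub>3.
      f (pure3 \<alpha>\<^sub>1 u \<alpha>\<^sub>2 v \<alpha>\<^sub>3 w) = T (\<alpha>\<^sub>1, \<alpha>\<^sub>2, \<alpha>\<^sub>3) u v w)"
  proof (rule pure3_ex1)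
    fix k :: "'g \<times> 'g \<times> 'g" and u v w
    obtain \<alpha>\<^sub>1 \<alpha>\<^sub>2 \<alpha>\<^sub>3 where k: "k = (\<alpha>\<^sub>1, \<alpha>\<^sub>2, \<alpha>\<^sub>3)"
      by (cases k)
    show "clinear (\<lambda>w. T k u v w)"
      unfolding k T_def prod.case
      by (rule clinear_compose [OF clinear_compose [OF clinear_pure2 Y(1)] clinear_append_left])
    show "clinear (\<lambda>v. T k u v w)"
      unfolding k T_def prod.case
      by (rule clinear_compose [OF clinear_compose [OF clinear_pure2' Y(1)] clinear_append_left])
    show "clinear (\<lambda>u. T k u v w)"
      by (simp add: k T_def clinear_append_left')
  next
    show "T (\<alpha>\<^sub>1, \<alpha>\<^sub>2, \<alpha>\<^sub>3) u v w \<in> graded_tensor3 G V \<gamma>"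
      if "(\<alpha>\<^sub>1, \<alpha>\<^sub>2, \<alpha>\<^sub>3) \<in> comp_triples G \<gamma>" "u \<in> V \<alpha>\<^sub>1" for \<alpha>\<^sub>1 \<alpha>\<^sub>2 \<alpha>\<^sub>3 u v w
      unfolding T_def prod.case by (rule append_left_in [OF that(1) Y(2) that(2)])
  qed
  moreover have "(\<forall>(\<alpha>\<^sub>1, \<alpha>\<^sub>2, \<alpha>\<^sub>3) \<in> comp_triples G \<gamma>. \<forall>u\<in>V \<alpha>\<^sub>1. \<forall>v\<in>V \<alpha>\<^sub>2. \<forall>w\<in>V \<alpha>\<^sub>3.
      f (pure3 \<alpha>\<^sub>1 u \<alpha>\<^sub>2 v \<alpha>\<^sub>3 w) = T (\<alpha>\<^sub>1, \<alpha>\<^sub>2, \<alpha>\<^sub>3) u v w) \<longleftrightarrow>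
    (\<forall>(\<alpha>\<^sub>1, \<alpha>\<^sub>2, \<alpha>\<^sub>3) \<in> comp_triples G \<gamma>. \<forall>u\<in>V \<alpha>\<^sub>1. \<forall>v\<in>V \<alpha>\<^sub>2. \<forall>w\<in>V \<alpha>\<^sub>3.
      f (pure3 \<alpha>\<^sub>1 u \<alpha>\<^sub>2 v \<alpha>\<^sub>3 w)
        = append_left \<alpha>\<^sub>1 u (X (Tgt G \<alpha>\<^sub>1) (Cmp G \<alpha>\<^sub>3 \<alpha>\<^sub>2) (pure2 \<alpha>\<^sub>2 v \<alpha>\<^sub>3 w)))" for f
    by (auto simp: T)
  ultimately show ?thesis
    unfolding is_op23_def by simp
qed

end

end

theory Submission
  imports Defs
begin

text \<open>
  Put \<open>A = U\<^sup>(\<^sup>1\<^sup>2\<^sup>)\<close>, \<open>B = U\<^sup>(\<^sup>2\<^sup>3\<^sup>)\<close>, \<open>E = K\<^sup>(\<^sup>1\<^sup>2\<^sup>)\<close> and \<open>F = K\<^sup>(\<^sup>2\<^sup>3\<^sup>)\<close> on \<open>(V \<otimes> V \<otimes> V)\<^sub>\<gamma>\<close>.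
  Because \<open>q\<close> and \<open>\<nu>\<close> are constant along arrows, the shift by \<open>h\<^sup>(\<^sup>1\<^sup>)\<close> does not change them: on
  a fixed degree \<open>\<gamma>\<close> the scalars are the numbers \<open>q a\<close> and \<open>\<nu> a\<close> with \<open>a\<close> the source of \<open>\<gamma>\<close>.
  So \<open>A\<close>, \<open>B\<close>, \<open>E\<close>, \<open>F\<close> represent the ordinary Birman--Murakami--Wenzl algebra on three
  strands (\<open>bmw_strands_on_graded_tensor3\<close>), and the claim becomes the Yang--Baxter equation for
  its Baxterization \<open>A + s(t) + r(t) E\<close>, where
  \<open>s(t) = z / (t - 1)\<close>, \<open>r(t) = z / (1 + \<nu>\<^sup>-\<^sup>1 q t)\<close> and \<open>z = q - q\<^sup>-\<^sup>1\<close>. With \<open>x = u\<^sub>2 / u\<^sub>1\<close> and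
  \<open>y = u\<^sub>3 / u\<^sub>2\<close> the three spectral parameters are \<open>x\<close>, \<open>y\<close> and \<open>x y\<close>.

  The defining relations imply \<open>E F E = E\<close> and \<open>A B E = F E\<close>, and from these every word of
  length three that occurs in the equation can be shortened, apart from \<open>ABA\<close>, \<open>BAB\<close>, \<open>AFA\<close>
  and \<open>BEB\<close>. The relations are symmetric under
  the anti-automorphism that exchanges \<open>A\<close> with \<open>B\<close> and \<open>E\<close> with \<open>F\<close> and reverses words, and
  this symmetry exchanges the two sides of the equation. The invariant words \<open>1\<close>, \<open>AB\<close>, \<open>BA\<close>,
  \<open>EF\<close>, \<open>FE\<close> and \<open>ABA = BAB\<close> therefore cancel in the difference of the sides, and what is
  left is a combination of \<open>A - B\<close>, \<open>AF - EB\<close>, \<open>FA - BE\<close> and \<open>E - F\<close>, plus a multiple of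
  \<open>AFA - BEB\<close> that reduces to these because \<open>(A - z) F (A - z) = (B - z) E (B - z)\<close>
  (\<open>A_F_A\<close>). The theorem thus comes down to four identities between the
  functions \<open>s\<close> and \<open>r\<close> (\<open>Yang_Baxter\<close> and \<open>spectral_coefficients\<close>).
\<close>

section \<open>Linear endomorphisms of a subspace\<close>

lemma linear_endo_mem: "linear_endo S f \<Longrightarrow> x \<in> S \<Longrightarrow> f x \<in> S"
  and linear_endo_add: "linear_endo S f \<Longrightarrow> x \<in> S \<Longrightarrow> y \<in> S \<Longrightarrow> f (x + y) = f x + f y"
  and linear_endo_scale: "linear_endo S f \<Longrightarrow> x \<in> S \<Longrightarrow> f (c *\<^sub>C x) = c *\<^sub>C f x"
  by (simp_all add: linear_endo_def)

lemma linear_endo_diff: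
  assumes "cvec.subspace S" "linear_endo S f" "x \<in> S" "y \<in> S"
  shows "f (x - y) = f x - f y"
  using linear_endo_add[OF assms(2) cvec.subspace_diff[OF assms(1,3,4)] assms(4)]
  by (simp add: algebra_simps)

lemma linear_endo_compose:
  assumes "linear_endo S f" "linear_endo S g"
  shows "linear_endo S (\<lambda>x. f (g x))"
  using assms by (simp add: linear_endo_def)

lemma linear_endo_combination:
  assumes S: "cvec.subspace S" and f: "linear_endo S f" and g: "linear_endo S g"
  shows "linear_endo S (\<lambda>x. b *\<^sub>C x + c *\<^sub>C f x + d *\<^sub>C g x)"
  unfolding linear_endo_def
  by (auto simp: linear_endo_mem[OF f] linear_endo_mem[OF g] linear_endo_add[OF f]
      linear_endo_add[OF g] linear_endo_scale[OF f] linear_endo_scale[OF g] scaleC_add_right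
      scaleC_scaleC mult.commute intro!: cvec.subspace_add[OF S] cvec.subspace_scale[OF S])

lemma linear_endo_scaled:
  assumes S: "cvec.subspace S" and f: "linear_endo S f"
  shows "linear_endo S (\<lambda>x. c *\<^sub>C f x)"
  using linear_endo_combination[OF S f f, of 0 c 0] by simp

lemma linear_endo_inv_into:
  assumes S: "cvec.subspace S" and f: "linear_endo S f" and bij: "bij_betw f S S"
  shows "linear_endo S (inv_into S f)"
proof -
  note mem = bij_betw_apply[OF bij_betw_inv_into[OF bij]]
  have eq: "inv_into S f y = x" if "x \<in> S" "f x = y" for x y
    using that bij_betw_inv_into_left[OF bij] by blast
  show ?thesis
    unfolding linear_endo_def
    by (auto intro!: eq cvec.subspace_add[OF S] cvec.subspace_scale[OF S]
        simp: mem linear_endo_add[OF f] linear_endo_scale[OF f] bij_betw_inv_into_right[OF bij])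
qed

section \<open>Three strands of a Birman--Murakami--Wenzl algebra\<close>

text \<open>The operators of the Birman--Murakami--Wenzl algebra on three strands, with \<open>A\<close> and \<open>E\<close>
  acting on the first two strands, \<open>B\<close> and \<open>F\<close> on the last two. They act on a subspace rather
  than on a whole type, since a graded component is not a type; equations between operators are
  therefore stated on the vectors of \<open>S\<close>. The assumption \<open>skein_A\<close> is the definition of \<open>E\<close>
  solved for \<open>A\<close>.\<close>

locale bmw_strands =
  fixes S :: "'a::complex_vector set" and A A' B B' E F :: "'a \<Rightarrow> 'a" and z \<nu> :: complex
  assumes S: "cvec.subspace S"
    and endo: "linear_endo S A" "linear_endo S A'" "linear_endo S E"
      "linear_endo S B" "linear_endo S B'" "linear_endo S F"
    and nonzero: "z \<noteq> 0" "\<nu> \<noteq> 0"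
    and inverse_A: "x \<in> S \<Longrightarrow> A (A' x) = x" "x \<in> S \<Longrightarrow> A' (A x) = x"
    and inverse_B: "x \<in> S \<Longrightarrow> B (B' x) = x" "x \<in> S \<Longrightarrow> B' (B x) = x"
    and skein_A: "x \<in> S \<Longrightarrow> A x = A' x + z *\<^sub>C x - z *\<^sub>C E x"
    and skein_B: "x \<in> S \<Longrightarrow> B x = B' x + z *\<^sub>C x - z *\<^sub>C F x"
    and braid: "x \<in> S \<Longrightarrow> A (B (A x)) = B (A (B x))"
    and twist_E: "x \<in> S \<Longrightarrow> A (E x) = \<nu> *\<^sub>C E x" "x \<in> S \<Longrightarrow> E (A x) = \<nu> *\<^sub>C E x"
    and twist_F: "x \<in> S \<Longrightarrow> B (F x) = \<nu> *\<^sub>C F x" "x \<in> S \<Longrightarrow> F (B x) = \<nu> *\<^sub>C F x"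
    and loop_E: "x \<in> S \<Longrightarrow> E (B (E x)) = (1 / \<nu>) *\<^sub>C E x" "x \<in> S \<Longrightarrow> E (B' (E x)) = \<nu> *\<^sub>C E x"
    and loop_F: "x \<in> S \<Longrightarrow> F (A (F x)) = (1 / \<nu>) *\<^sub>C F x" "x \<in> S \<Longrightarrow> F (A' (F x)) = \<nu> *\<^sub>C F x"
begin

text \<open>Exchanging the two pairs of strands preserves the relations, so that every lemma below also
  holds with \<open>A\<close> and \<open>B\<close>, and \<open>E\<close> and \<open>F\<close>, interchanged.\<close>

sublocale swap: bmw_strands S B B' A A' F E z \<nu>
  by unfold_locales
    (fact S endo nonzero inverse_A inverse_B skein_A skein_B braid[symmetric] twist_E twist_F
      loop_E loop_F)+

lemmas closed = endo[THEN linear_endo_mem] cvec.subspace_add[OF S] cvec.subspace_diff[OF S]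
  cvec.subspace_scale[OF S]

lemmas linear = endo[THEN linear_endo_add] endo[THEN linear_endo_scale]
  endo[THEN linear_endo_diff[OF S]]

lemma twist_inverse_E:
  assumes "x \<in> S"
  shows "A' (E x) = (1 / \<nu>) *\<^sub>C E x"
proof -
  have "E x = A' (A (E x))"
    using assms by (simp add: inverse_A closed)
  also have "\<dots> = \<nu> *\<^sub>C A' (E x)"
    using assms by (simp add: twist_E linear closed)
  finally have "(1 / \<nu>) *\<^sub>C E x = (1 / \<nu>) *\<^sub>C \<nu> *\<^sub>C A' (E x)"
    by simp
  then show ?thesis
    using nonzero by (simp add: scaleC_scaleC scaleC_one)
qed

lemma E_squared:
  assumes "x \<in> S"
  shows "E (E x) = (1 - (\<nu> - 1 / \<nu>) / z) *\<^sub>C E x"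
proof -
  have "\<nu> *\<^sub>C E x = (1 / \<nu>) *\<^sub>C E x + z *\<^sub>C E x - z *\<^sub>C E (E x)"
    using skein_A[of "E x"] assms by (simp add: twist_E twist_inverse_E closed)
  then have "z *\<^sub>C E (E x) = (1 / \<nu> + z - \<nu>) *\<^sub>C E x"
    by (simp add: algebra_simps cvec.scale_left_distrib cvec.scale_left_diff_distrib)
  then have "(1 / z) *\<^sub>C z *\<^sub>C E (E x) = (1 / z) *\<^sub>C (1 / \<nu> + z - \<nu>) *\<^sub>C E x"
    by simp
  moreover have "1 / z * (1 / \<nu> + z - \<nu>) = 1 - (\<nu> - 1 / \<nu>) / z"
    using nonzero by (simp add: field_simps)
  ultimately show ?thesis
    using nonzero by (simp add: scaleC_scaleC scaleC_one)
qed

text \<open>Sandwich the skein relation for \<open>B\<close> between two copies of \<open>E\<close>: the loop relations and the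
  value of \<open>E\<^sup>2\<close> make the remaining terms add up to \<open>z E\<close>.\<close>

lemma E_F_E:
  assumes "x \<in> S"
  shows "E (F (E x)) = E x"
proof -
  have "E (B (E x)) = E (B' (E x)) + z *\<^sub>C E (E x) - z *\<^sub>C E (F (E x))"
    using assms by (subst skein_B) (simp_all add: linear closed)
  then have "z *\<^sub>C E (F (E x)) = z *\<^sub>C E (E x) + (\<nu> - 1 / \<nu>) *\<^sub>C E x"
    using assms by (simp add: loop_E algebra_simps cvec.scale_left_diff_distrib)
  also have "\<dots> = (z * (1 - (\<nu> - 1 / \<nu>) / z) + (\<nu> - 1 / \<nu>)) *\<^sub>C E x"
    using assms by (simp only: E_squared scaleC_scaleC scaleC_add_left)
  also have "z * (1 - (\<nu> - 1 / \<nu>) / z) + (\<nu> - 1 / \<nu>) = z"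
    using nonzero by (simp add: right_diff_distrib diff_divide_distrib)
  finally show ?thesis
    using nonzero by simp
qed

text \<open>The braid relation gives \<open>A B A\<^sup>-\<^sup>1 = B\<^sup>-\<^sup>1 A B\<close>. As \<open>E\<close> is a combination of \<open>A\<close>, \<open>A\<^sup>-\<^sup>1\<close>
  and the identity, and \<open>F\<close> is the same combination for \<open>B\<close>, the product \<open>A B\<close> also conjugates
  \<open>E\<close> into \<open>F\<close>.\<close>

lemma A_B_E_slide:
  assumes x: "x \<in> S"
  shows "A (B (E x)) = F (A (B x))"
proof -
  have "A (B (A' x)) = B' (A (B x))"
  proof -
    have "A (B (A' x)) = B' (B (A (B (A' x))))"
      using x by (simp add: inverse_B closed)
    also have "\<dots> = B' (A (B (A (A' x))))"
      using x by (simp add: braid closed)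
    finally show ?thesis
      using x by (simp add: inverse_A)
  qed
  moreover have "z *\<^sub>C E x = A' x + z *\<^sub>C x - A x"
    "z *\<^sub>C F (A (B x)) = B' (A (B x)) + z *\<^sub>C A (B x) - B (A (B x))"
    using skein_A[OF x] skein_B[of "A (B x)"] x by (simp_all add: closed)
  moreover have "z *\<^sub>C A (B (E x)) = A (B (z *\<^sub>C E x))"
    using x by (simp add: linear closed)
  ultimately have "z *\<^sub>C A (B (E x)) = z *\<^sub>C F (A (B x))"
    using x by (simp add: linear closed braid)
  then show ?thesis
    using nonzero by simp
qed

text \<open>The loop relation for \<open>F\<close> becomes applicable once \<open>E\<close> is written as \<open>E F E\<close>:
  \<open>A B E = A B E F E = F A B F E = \<nu> F A F E = F E\<close>.\<close>

lemma A_B_E: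
  assumes x: "x \<in> S"
  shows "A (B (E x)) = F (E x)"
proof -
  have "A (B (E x)) = A (B (E (F (E x))))"
    using x by (simp add: E_F_E)
  also have "\<dots> = F (A (B (F (E x))))"
    using x by (simp add: A_B_E_slide closed)
  also have "\<dots> = F (E x)"
    using x nonzero by (simp add: twist_F loop_F linear closed scaleC_scaleC scaleC_one)
  finally show ?thesis .
qed

end

context bmw_strands
begin

text \<open>The interchange of strands does not reverse words, so this mirror image of \<open>A B E = F E\<close> needs
  the sliding relation: \<open>E B A = B A F = E F\<close>.\<close>

lemma E_B_A:
  assumes x: "x \<in> S"
  shows "E (B (A x)) = E (F x)"
  using x by (simp flip: swap.A_B_E_slide add: swap.A_B_E)

lemma A_F_E:
  assumes x: "x \<in> S"
  shows "A (F (E x)) = B (E x) + z *\<^sub>C F (E x) - z *\<^sub>C E x"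
proof -
  have "A' (F (E x)) = B (E x)"
    using A_B_E[OF x] inverse_A(2)[of "B (E x)"] x by (simp add: closed)
  then show ?thesis
    using skein_A[of "F (E x)"] x by (simp add: E_F_E closed)
qed

lemma E_F_A':
  assumes x: "x \<in> S"
  shows "E (F (A' x)) = E (B x)"
  using E_B_A[of "A' x"] x by (simp add: inverse_A closed)

lemma E_F_A:
  assumes x: "x \<in> S"
  shows "E (F (A x)) = E (B x) + z *\<^sub>C E (F x) - z *\<^sub>C E x"
  using x by (simp add: skein_A linear closed E_F_A' E_F_E)

lemma B'_eq: "x \<in> S \<Longrightarrow> B' x = B x - z *\<^sub>C x + z *\<^sub>C F x"
  by (simp add: skein_B)

end

context bmw_strands
begin

text \<open>This is \<open>(A - z) F (A - z) = (B - z) E (B - z)\<close> multiplied out. Sliding gives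
  \<open>F A = F E B\<^sup>-\<^sup>1\<close> and \<open>A F = B\<^sup>-\<^sup>1 E F\<close>, hence \<open>A F A = B\<^sup>-\<^sup>1 E B\<^sup>-\<^sup>1\<close>, and the skein
  relation removes the inverses.\<close>

lemma A_F_A:
  assumes x: "x \<in> S"
  shows "A (F (A x)) = B (E (B x)) + z *\<^sub>C (A (F x) + F (A x) - B (E x) - E (B x))
    + (z * z) *\<^sub>C (E x - F x)"
proof -
  have "A (F (A x)) = A (F (E (B' x)))"
    using x by (simp add: swap.E_F_A')
  also have "\<dots> = B (E (B' x)) + z *\<^sub>C F (E (B' x)) - z *\<^sub>C E (B' x)"
    using x by (simp add: A_F_E closed)
  also have "F (E (B' x)) = F (A x)"
    using x by (simp add: swap.E_F_A')
  finally show ?thesis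
    using x by (simp add: B'_eq linear closed swap.A_F_E cvec.scale_right_distrib
      cvec.scale_right_diff_distrib scaleC_scaleC algebra_simps)
qed

lemma A_squared:
  assumes x: "x \<in> S"
  shows "A (A x) = x + z *\<^sub>C A x - (z * \<nu>) *\<^sub>C E x"
  using skein_A[of "A x"] x by (simp add: inverse_A twist_E closed scaleC_scaleC)

end

context bmw_strands
begin

text \<open>The coefficients \<open>s\<^sub>i\<close>, \<open>r\<^sub>i\<close> are the values at three spectral parameters, the third of
  which is the product of the others in the application. The four hypotheses on the
  coefficients say that the differences \<open>A - B\<close>, \<open>AF - EB\<close>, \<open>FA - BE\<close> and \<open>E - F\<close>,
  respectively, drop out of the difference of the two sides.\<close>

theorem Yang_Baxter:
  fixes s\<^sub>1 s\<^sub>2 s\<^sub>3 r\<^sub>1 r\<^sub>2 r\<^sub>3 :: complex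
  defines "P \<equiv> \<lambda>s r x. A x + s *\<^sub>C x + r *\<^sub>C E x"
    and "Q \<equiv> \<lambda>s r x. B x + s *\<^sub>C x + r *\<^sub>C F x"
  assumes A_B: "s\<^sub>3 * (z + s\<^sub>1 + s\<^sub>2) = s\<^sub>1 * s\<^sub>2"
    and AF_EB: "r\<^sub>3 * (z + s\<^sub>1 - r\<^sub>2) = s\<^sub>1 * r\<^sub>2"
    and FA_BE: "r\<^sub>3 * (z + s\<^sub>2 - r\<^sub>1) = s\<^sub>2 * r\<^sub>1"
    and E_F: "z * \<nu> * s\<^sub>3 - \<nu> * s\<^sub>3 * (r\<^sub>1 + r\<^sub>2) + s\<^sub>1 * s\<^sub>2 * r\<^sub>3 + z * r\<^sub>3 * (r\<^sub>1 + r\<^sub>2) - z * z * r\<^sub>3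
      = s\<^sub>2 * s\<^sub>3 * r\<^sub>1 + s\<^sub>1 * s\<^sub>3 * r\<^sub>2
        + r\<^sub>1 * r\<^sub>2 * (1 / \<nu> + s\<^sub>3 * (1 - (\<nu> - 1 / \<nu>) / z) + r\<^sub>3)"
    and x: "x \<in> S"
  shows "P s\<^sub>2 r\<^sub>2 (Q s\<^sub>3 r\<^sub>3 (P s\<^sub>1 r\<^sub>1 x)) = Q s\<^sub>1 r\<^sub>1 (P s\<^sub>3 r\<^sub>3 (Q s\<^sub>2 r\<^sub>2 x))"
proof -
  define \<delta> where "\<delta> = 1 - (\<nu> - 1 / \<nu>) / z"
  note squares = E_squared[folded \<delta>_def] swap.E_squared[folded \<delta>_def]
  let ?k = "s\<^sub>2 * s\<^sub>3 * r\<^sub>1 + s\<^sub>1 * s\<^sub>3 * r\<^sub>2 + r\<^sub>1 * r\<^sub>2 * (1 / \<nu> + s\<^sub>3 * \<delta> + r\<^sub>3)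
    - (z * \<nu> * s\<^sub>3 - \<nu> * s\<^sub>3 * (r\<^sub>1 + r\<^sub>2) + s\<^sub>1 * s\<^sub>2 * r\<^sub>3 + z * r\<^sub>3 * (r\<^sub>1 + r\<^sub>2) - z * z * r\<^sub>3)"
  note expand = P_def Q_def linear closed x scaleC_add_right cvec.scale_right_diff_distrib
    scaleC_add_left cvec.scale_left_diff_distrib scaleC_scaleC A_squared swap.A_squared squares
    twist_E twist_F E_F_E swap.E_F_E loop_E(1) loop_F(1) A_B_E swap.A_B_E E_B_A swap.E_B_A
    A_F_E swap.A_F_E E_F_A swap.E_F_A
  have "P s\<^sub>2 r\<^sub>2 (Q s\<^sub>3 r\<^sub>3 (P s\<^sub>1 r\<^sub>1 x)) - Q s\<^sub>1 r\<^sub>1 (P s\<^sub>3 r\<^sub>3 (Q s\<^sub>2 r\<^sub>2 x))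
    = (s\<^sub>3 * (z + s\<^sub>1 + s\<^sub>2) - s\<^sub>1 * s\<^sub>2) *\<^sub>C (A x - B x)
      + (r\<^sub>3 * (z + s\<^sub>1 - r\<^sub>2) - s\<^sub>1 * r\<^sub>2) *\<^sub>C (A (F x) - E (B x))
      + (r\<^sub>3 * (z + s\<^sub>2 - r\<^sub>1) - s\<^sub>2 * r\<^sub>1) *\<^sub>C (F (A x) - B (E x))
      + ?k *\<^sub>C (E x - F x)"
    \<comment> \<open>The first step reduces all words; the second collects coefficients.\<close>
    by (simp add: expand braid A_F_A)
      (simp add: algebra_simps scaleC_add_left cvec.scale_left_diff_distrib)
  also have "\<dots> = 0"
    using A_B AF_EB FA_BE E_F by (simp add: \<delta>_def)
  finally show ?thesis
    by simp
qed

end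

section \<open>Operators on adjacent tensor factors\<close>

text \<open>A slot \<open>(\<delta>, J)\<close> consists of a degree and the map \<open>J\<close> that puts a tensor of
  \<open>(V \<otimes> V)\<^sub>\<delta>\<close> into two adjacent factors of \<open>(V \<otimes> V \<otimes> V)\<^sub>\<gamma>\<close>, next to a fixed vector in
  the remaining factor. An operator \<open>X\<^sup>(\<^sup>1\<^sup>2\<^sup>)\<close> or \<open>X\<^sup>(\<^sup>2\<^sup>3\<^sup>)\<close> satisfies \<open>f \<circ> J = J \<circ> X\<close> for all
  its slots; in both cases the object at which \<open>X\<close> is taken is the source of \<open>\<delta>\<close>. This makes it
  possible to transfer identities from \<open>V \<otimes> V\<close> to \<open>V \<otimes> V \<otimes> V\<close> once for both positions.\<close>

definition left_slots ::
    "('o, 'g) groupoid_data \<Rightarrow> ('g \<Rightarrow> 'v::complex_vector set) \<Rightarrow> 'g \<Rightarrow>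
      ('g \<times> (('g, 'v) tensor2 \<Rightarrow> ('g, 'v) tensor3)) set"
  where "left_slots G V \<gamma> = {(Cmp G \<alpha>\<^sub>2 \<alpha>\<^sub>1, \<lambda>y. append_right y \<alpha>\<^sub>3 w) | \<alpha>\<^sub>1 \<alpha>\<^sub>2 \<alpha>\<^sub>3 w.
    (\<alpha>\<^sub>1, \<alpha>\<^sub>2, \<alpha>\<^sub>3) \<in> comp_triples G \<gamma> \<and> w \<in> V \<alpha>\<^sub>3}"

definition right_slots ::
    "('o, 'g) groupoid_data \<Rightarrow> ('g \<Rightarrow> 'v::complex_vector set) \<Rightarrow> 'g \<Rightarrow>
      ('g \<times> (('g, 'v) tensor2 \<Rightarrow> ('g, 'v) tensor3)) set"
  where "right_slots G V \<gamma> = {(Cmp G \<alpha>\<^sub>3 \<alpha>\<^sub>2, append_left \<alpha>\<^sub>1 u) | \<alpha>\<^sub>1 \<alpha>\<^sub>2 \<alpha>\<^sub>3 u.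
    (\<alpha>\<^sub>1, \<alpha>\<^sub>2, \<alpha>\<^sub>3) \<in> comp_triples G \<gamma> \<and> u \<in> V \<alpha>\<^sub>1}"

definition acts_in_slots ::
    "('o, 'g) groupoid_data \<Rightarrow> ('g \<Rightarrow> 'v::complex_vector set) \<Rightarrow> 'g \<Rightarrow>
      ('g \<times> (('g, 'v) tensor2 \<Rightarrow> ('g, 'v) tensor3)) set \<Rightarrow> ('o, 'g, 'v) op_family \<Rightarrow>
      (('g, 'v) tensor3 \<Rightarrow> ('g, 'v) tensor3) \<Rightarrow> bool"
  where "acts_in_slots G V \<gamma> D X f \<longleftrightarrow> linear_endo (graded_tensor3 G V \<gamma>) f \<and>
    (\<forall>(\<delta>, J) \<in> D. \<forall>y \<in> graded_tensor2 G V \<delta>. f (J y) = J (X (Src G \<delta>) \<delta> y))"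

lemma acts_in_slots_endo: "acts_in_slots G V \<gamma> D X f \<Longrightarrow> linear_endo (graded_tensor3 G V \<gamma>) f"
  and acts_in_slots_apply: "acts_in_slots G V \<gamma> D X f \<Longrightarrow> (\<delta>, J) \<in> D \<Longrightarrow>
    y \<in> graded_tensor2 G V \<delta> \<Longrightarrow> f (J y) = J (X (Src G \<delta>) \<delta> y)"
  by (auto simp: acts_in_slots_def)

lemma graded_endo_apply:
  "graded_endo G V X \<Longrightarrow> groupoid G \<Longrightarrow> \<delta> \<in> Arr G \<Longrightarrow>
    linear_endo (graded_tensor2 G V \<delta>) (X (Src G \<delta>) \<delta>)"
  by (simp add: graded_endo_def groupoid.Src_Obj)

context groupoid
begin

lemma comp_triples_left:
  assumes "(\<alpha>\<^sub>1, \<alpha>\<^sub>2, \<alpha>\<^sub>3) \<in> comp_triples G \<gamma>" "(\<alpha>, \<beta>) \<in> comp_pairs G (Cmp G \<alpha>\<^sub>2 \<alpha>\<^sub>1)"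
  shows "(\<alpha>, \<beta>, \<alpha>\<^sub>3) \<in> comp_triples G \<gamma>"
  using assms Tgt_Cmp[of \<alpha> \<beta>] Tgt_Cmp[of \<alpha>\<^sub>1 \<alpha>\<^sub>2] by (auto simp: comp_triples_def comp_pairs_def)

lemma comp_triples_right:
  assumes "(\<alpha>\<^sub>1, \<alpha>\<^sub>2, \<alpha>\<^sub>3) \<in> comp_triples G \<gamma>" "(\<alpha>, \<beta>) \<in> comp_pairs G (Cmp G \<alpha>\<^sub>3 \<alpha>\<^sub>2)"
  shows "(\<alpha>\<^sub>1, \<alpha>, \<beta>) \<in> comp_triples G \<gamma>"
  using assms Src_Cmp[of \<alpha> \<beta>] Src_Cmp[of \<alpha>\<^sub>2 \<alpha>\<^sub>3] Cmp_assoc[of \<alpha>\<^sub>1 \<alpha> \<beta>] Cmp_assoc[of \<alpha>\<^sub>1 \<alpha>\<^sub>2 \<alpha>\<^sub>3]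
  by (auto simp: comp_triples_def comp_pairs_def)

lemma slot_in:
  assumes "(\<delta>, J) \<in> left_slots G V \<gamma> \<or> (\<delta>, J) \<in> right_slots G V \<gamma>"
  shows "\<delta> \<in> Arr G" "clinear J" "y \<in> graded_tensor2 G V \<delta> \<Longrightarrow> J y \<in> graded_tensor3 G V \<gamma>"
  using assms
  by (auto simp: left_slots_def right_slots_def comp_triples_def Cmp_Arr clinear_append_right
      clinear_append_left intro: append_right_in append_left_in)

text \<open>The images of the slots span \<open>(V \<otimes> V \<otimes> V)\<^sub>\<gamma>\<close>, since they contain the pure tensors.\<close>

lemma eq_if_eq_on_slots:
  assumes D: "D = left_slots G V \<gamma> \<or> D = right_slots G V \<gamma>"
    and f: "linear_endo (graded_tensor3 G V \<gamma>) f" and g: "linear_endo (graded_tensor3 G V \<gamma>) g"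
    and eq: "\<And>\<delta> J y. \<lbrakk>(\<delta>, J) \<in> D; \<delta> \<in> Arr G; clinear J; y \<in> graded_tensor2 G V \<delta>\<rbrakk>
      \<Longrightarrow> f (J y) = g (J y)"
    and x: "x \<in> graded_tensor3 G V \<gamma>"
  shows "f x = g x"
proof (rule linear_endo_eq_on_span[OF f[unfolded graded_tensor3_eq_span]
      g[unfolded graded_tensor3_eq_span] _ x[unfolded graded_tensor3_eq_span]])
  fix t
  assume "t \<in> {pure3 \<alpha>\<^sub>1 u \<alpha>\<^sub>2 v \<alpha>\<^sub>3 w | \<alpha>\<^sub>1 \<alpha>\<^sub>2 \<alpha>\<^sub>3 u v w.
    (\<alpha>\<^sub>1, \<alpha>\<^sub>2, \<alpha>\<^sub>3) \<in> comp_triples G \<gamma> \<and> u \<in> V \<alpha>\<^sub>1 \<and> v \<in> V \<alpha>\<^sub>2 \<and> w \<in> V \<alpha>\<^sub>3}"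
  then obtain \<alpha>\<^sub>1 \<alpha>\<^sub>2 \<alpha>\<^sub>3 u v w where t: "t = pure3 \<alpha>\<^sub>1 u \<alpha>\<^sub>2 v \<alpha>\<^sub>3 w"
    "(\<alpha>\<^sub>1, \<alpha>\<^sub>2, \<alpha>\<^sub>3) \<in> comp_triples G \<gamma>" "u \<in> V \<alpha>\<^sub>1" "v \<in> V \<alpha>\<^sub>2" "w \<in> V \<alpha>\<^sub>3"
    by blast
  have pure: "pure2 \<alpha>\<^sub>1 u \<alpha>\<^sub>2 v \<in> graded_tensor2 G V (Cmp G \<alpha>\<^sub>2 \<alpha>\<^sub>1)"
    "pure2 \<alpha>\<^sub>2 v \<alpha>\<^sub>3 w \<in> graded_tensor2 G V (Cmp G \<alpha>\<^sub>3 \<alpha>\<^sub>2)"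
    using t by (auto simp: comp_triples_def intro: pure2_in)
  from D show "f t = g t"
  proof
    assume D: "D = left_slots G V \<gamma>"
    have "(Cmp G \<alpha>\<^sub>2 \<alpha>\<^sub>1, \<lambda>y. append_right y \<alpha>\<^sub>3 w) \<in> left_slots G V \<gamma>"
      using t unfolding left_slots_def by blast
    from eq[OF this[folded D] slot_in(1,2)[OF disjI1[OF this]] pure(1)] show ?thesis
      by (simp add: t append_right_pure2)
  next
    assume D: "D = right_slots G V \<gamma>"
    have "(Cmp G \<alpha>\<^sub>3 \<alpha>\<^sub>2, append_left \<alpha>\<^sub>1 u) \<in> right_slots G V \<gamma>"
      using t unfolding right_slots_def by blast
    from eq[OF this[folded D] slot_in(1,2)[OF disjI2[OF this]] pure(2)] show ?thesis
      by (simp add: t append_left_pure2)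
  qed
qed

text \<open>The operators on \<open>V \<otimes> V \<otimes> V\<close> are prescribed on pure tensors only. The relation
  \<open>f \<circ> J = J \<circ> X\<close> on all of \<open>(V \<otimes> V)\<^sub>\<delta>\<close> is what allows composing them.\<close>

lemma linear_endo_comparison:
  assumes X: "linear_endo (graded_tensor2 G V \<delta>) X" and f: "linear_endo (graded_tensor3 G V \<gamma>) f"
    and J: "clinear J" "\<And>y. y \<in> graded_tensor2 G V \<delta> \<Longrightarrow> J y \<in> graded_tensor3 G V \<gamma>"
    and pure: "\<And>\<alpha> \<beta> u v. \<lbrakk>(\<alpha>, \<beta>) \<in> comp_pairs G \<delta>; u \<in> V \<alpha>; v \<in> V \<beta>\<rbrakk>
      \<Longrightarrow> f (J (pure2 \<alpha> u \<beta> v)) = J (X (pure2 \<alpha> u \<beta> v))"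
    and y: "y \<in> graded_tensor2 G V \<delta>"
  shows "f (J y) = J (X y)"
proof -
  let ?T = "graded_tensor2 G V \<delta>"
  let ?A = "{pure2 \<alpha> u \<beta> v | \<alpha> \<beta> u v. (\<alpha>, \<beta>) \<in> comp_pairs G \<delta> \<and> u \<in> V \<alpha> \<and> v \<in> V \<beta>}"
  note T = cvec.subspace_0[OF subspace_graded_tensor2] cvec.subspace_add[OF subspace_graded_tensor2]
    cvec.subspace_scale[OF subspace_graded_tensor2]
  have zero: "h 0 = 0" if "linear_endo R h" "0 \<in> R" for h :: "'x::complex_vector \<Rightarrow> 'x" and R
    using linear_endo_scale[OF that, of 0] by simp
  have "cvec.subspace {y \<in> ?T. f (J y) = J (X y)}"
    using zero[OF X T(1)] zero[OF f cvec.subspace_0[OF subspace_graded_tensor3]]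
    by (intro cvec.subspaceI)
      (auto simp: T clinear_zero[OF J(1)] clinear_add[OF J(1)] clinear_scale[OF J(1)] J(2)
        linear_endo_add[OF X] linear_endo_add[OF f] linear_endo_scale[OF X] linear_endo_scale[OF f])
  moreover have "?A \<subseteq> {y \<in> ?T. f (J y) = J (X y)}"
  proof
    fix t assume t: "t \<in> ?A"
    have "t \<in> ?T"
      unfolding graded_tensor2_eq_span using t by (rule cvec.span_base)
    then show "t \<in> {y \<in> ?T. f (J y) = J (X y)}"
      using t pure by blast
  qed
  ultimately have "cvec.span ?A \<subseteq> {y \<in> ?T. f (J y) = J (X y)}"
    by (intro cvec.span_minimal)
  then have "?T \<subseteq> {y \<in> ?T. f (J y) = J (X y)}"
    by (simp only: graded_tensor2_eq_span[symmetric])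
  then show ?thesis
    using y by blast
qed

lemma op12_acts:
  assumes X: "graded_endo G V X"
  shows "acts_in_slots G V \<gamma> (left_slots G V \<gamma>) X (op12 G V X (Src G \<gamma>) \<gamma>)"
proof -
  have op: "is_op12 G V X (Src G \<gamma>) \<gamma> (op12 G V X (Src G \<gamma>) \<gamma>)"
    unfolding op12_def by (rule theI' [OF op12_ex1[OF X refl]])
  then have endo: "linear_endo (graded_tensor3 G V \<gamma>) (op12 G V X (Src G \<gamma>) \<gamma>)"
    by (simp add: is_op12_def)
  have "op12 G V X (Src G \<gamma>) \<gamma> (J y) = J (X (Src G \<delta>) \<delta> y)"
    if slot: "(\<delta>, J) \<in> left_slots G V \<gamma>" and y: "y \<in> graded_tensor2 G V \<delta>" for \<delta> J y
  proof (rule linear_endo_comparison[OF _ endo _ _ _ y])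
    show "linear_endo (graded_tensor2 G V \<delta>) (X (Src G \<delta>) \<delta>)"
      using graded_endo_apply[OF X groupoid_axioms] slot_in(1) slot by blast
    show "clinear J"
      using slot_in(2)[OF disjI1[OF slot]] .
    show "J y \<in> graded_tensor3 G V \<gamma>" if "y \<in> graded_tensor2 G V \<delta>" for y
      using slot_in(3)[OF disjI1[OF slot] that] .
    fix \<alpha> \<beta> u v
    assume pair: "(\<alpha>, \<beta>) \<in> comp_pairs G \<delta>" and uv: "u \<in> V \<alpha>" "v \<in> V \<beta>"
    obtain \<alpha>\<^sub>1 \<alpha>\<^sub>2 \<alpha>\<^sub>3 w where k: "(\<alpha>\<^sub>1, \<alpha>\<^sub>2, \<alpha>\<^sub>3) \<in> comp_triples G \<gamma>" "w \<in> V \<alpha>\<^sub>3"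
      and \<delta>: "\<delta> = Cmp G \<alpha>\<^sub>2 \<alpha>\<^sub>1" and J: "J = (\<lambda>y. append_right y \<alpha>\<^sub>3 w)"
      using slot unfolding left_slots_def by blast
    have triple: "(\<alpha>, \<beta>, \<alpha>\<^sub>3) \<in> comp_triples G \<gamma>"
      using comp_triples_left k(1) pair \<delta> by blast
    have src: "Src G \<delta> = Src G \<gamma>" "Cmp G \<beta> \<alpha> = \<delta>"
      using k(1) pair \<delta> by (auto simp: comp_triples_def comp_pairs_def Src_Cmp Tgt_Cmp Cmp_Arr)
    show "op12 G V X (Src G \<gamma>) \<gamma> (J (pure2 \<alpha> u \<beta> v)) = J (X (Src G \<delta>) \<delta> (pure2 \<alpha> u \<beta> v))"
      using op triple uv k(2) unfolding is_op12_def J append_right_pure2 src(1)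
      unfolding src(2)[symmetric] by blast
  qed
  then show ?thesis
    using endo by (auto simp: acts_in_slots_def)
qed

lemma op23_acts:
  assumes X: "graded_endo G V X"
  shows "acts_in_slots G V \<gamma> (right_slots G V \<gamma>) X (op23 G V X \<gamma>)"
proof -
  have op: "is_op23 G V X \<gamma> (op23 G V X \<gamma>)"
    unfolding op23_def by (rule theI' [OF op23_ex1[OF X]])
  then have endo: "linear_endo (graded_tensor3 G V \<gamma>) (op23 G V X \<gamma>)"
    by (simp add: is_op23_def)
  have "op23 G V X \<gamma> (J y) = J (X (Src G \<delta>) \<delta> y)"
    if slot: "(\<delta>, J) \<in> right_slots G V \<gamma>" and y: "y \<in> graded_tensor2 G V \<delta>" for \<delta> J y
  proof (rule linear_endo_comparison[OF _ endo _ _ _ y])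
    show "linear_endo (graded_tensor2 G V \<delta>) (X (Src G \<delta>) \<delta>)"
      using graded_endo_apply[OF X groupoid_axioms] slot_in(1) slot by blast
    show "clinear J"
      using slot_in(2)[OF disjI2[OF slot]] .
    show "J y \<in> graded_tensor3 G V \<gamma>" if "y \<in> graded_tensor2 G V \<delta>" for y
      using slot_in(3)[OF disjI2[OF slot] that] .
    fix \<alpha> \<beta> u v
    assume pair: "(\<alpha>, \<beta>) \<in> comp_pairs G \<delta>" and uv: "u \<in> V \<alpha>" "v \<in> V \<beta>"
    obtain \<alpha>\<^sub>1 \<alpha>\<^sub>2 \<alpha>\<^sub>3 w where k: "(\<alpha>\<^sub>1, \<alpha>\<^sub>2, \<alpha>\<^sub>3) \<in> comp_triples G \<gamma>" "w \<in> V \<alpha>\<^sub>1"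
      and \<delta>: "\<delta> = Cmp G \<alpha>\<^sub>3 \<alpha>\<^sub>2" and J: "J = append_left \<alpha>\<^sub>1 w"
      using slot unfolding right_slots_def by blast
    have triple: "(\<alpha>\<^sub>1, \<alpha>, \<beta>) \<in> comp_triples G \<gamma>"
      using comp_triples_right k(1) pair \<delta> by blast
    have src: "Src G \<delta> = Tgt G \<alpha>\<^sub>1" "Cmp G \<beta> \<alpha> = \<delta>"
      using k(1) pair \<delta> by (auto simp: comp_triples_def comp_pairs_def Src_Cmp)
    show "op23 G V X \<gamma> (J (pure2 \<alpha> u \<beta> v)) = J (X (Src G \<delta>) \<delta> (pure2 \<alpha> u \<beta> v))"
      using op triple uv k(2) unfolding is_op23_def J append_left_pure2 src(1)
      unfolding src(2)[symmetric] by blast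
  qed
  then show ?thesis
    using endo by (auto simp: acts_in_slots_def)
qed

lemma slot_operator_combination:
  assumes D: "D = left_slots G V \<gamma> \<or> D = right_slots G V \<gamma>"
    and X: "acts_in_slots G V \<gamma> D X f" and Y: "acts_in_slots G V \<gamma> D Y g"
    and Z: "acts_in_slots G V \<gamma> D Z h"
    and eq: "\<And>\<delta> J y. \<lbrakk>(\<delta>, J) \<in> D; y \<in> graded_tensor2 G V \<delta>\<rbrakk> \<Longrightarrow>
      Z (Src G \<delta>) \<delta> y = b *\<^sub>C y + c *\<^sub>C X (Src G \<delta>) \<delta> y + d *\<^sub>C Y (Src G \<delta>) \<delta> y"
    and x: "x \<in> graded_tensor3 G V \<gamma>"
  shows "h x = b *\<^sub>C x + c *\<^sub>C f x + d *\<^sub>C g x"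
proof (rule eq_if_eq_on_slots[OF D acts_in_slots_endo[OF Z] _ _ x])
  show "linear_endo (graded_tensor3 G V \<gamma>) (\<lambda>x. b *\<^sub>C x + c *\<^sub>C f x + d *\<^sub>C g x)"
    by (rule linear_endo_combination)
      (fact subspace_graded_tensor3 acts_in_slots_endo[OF X] acts_in_slots_endo[OF Y])+
qed (simp add: acts_in_slots_apply[OF X] acts_in_slots_apply[OF Y] acts_in_slots_apply[OF Z] eq
    clinear_add clinear_scale)

lemma slot_operator_product:
  assumes D: "D = left_slots G V \<gamma> \<or> D = right_slots G V \<gamma>"
    and X: "acts_in_slots G V \<gamma> D X f" and Y: "acts_in_slots G V \<gamma> D Y g"
    and endo: "graded_endo G V Y"
    and h: "linear_endo (graded_tensor3 G V \<gamma>) h"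
    and eq: "\<And>\<delta> J y. \<lbrakk>(\<delta>, J) \<in> D; \<delta> \<in> Arr G; clinear J; y \<in> graded_tensor2 G V \<delta>\<rbrakk> \<Longrightarrow>
      J (X (Src G \<delta>) \<delta> (Y (Src G \<delta>) \<delta> y)) = h (J y)"
    and x: "x \<in> graded_tensor3 G V \<gamma>"
  shows "f (g x) = h x"
proof (rule eq_if_eq_on_slots[OF D _ h _ x])
  show "linear_endo (graded_tensor3 G V \<gamma>) (\<lambda>x. f (g x))"
    using acts_in_slots_endo[OF X] acts_in_slots_endo[OF Y] by (rule linear_endo_compose)
  show "f (g (J y)) = h (J y)"
    if "(\<delta>, J) \<in> D" "\<delta> \<in> Arr G" "clinear J" "y \<in> graded_tensor2 G V \<delta>" for \<delta> J y
    using that linear_endo_mem[OF graded_endo_apply[OF endo groupoid_axioms]]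
    by (simp add: acts_in_slots_apply[OF X] acts_in_slots_apply[OF Y] eq)
qed

text \<open>The source of a right slot is the target of the first arrow of a composable triple. That arrow
  connects it to the source of \<open>\<gamma>\<close>, so that constancy along arrows applies.\<close>

lemma slot_source_invariant:
  assumes inv: "\<And>\<alpha>. \<alpha> \<in> Arr G \<Longrightarrow> p (Src G \<alpha>) = p (Tgt G \<alpha>)"
    and "(\<delta>, J) \<in> left_slots G V \<gamma> \<or> (\<delta>, J) \<in> right_slots G V \<gamma>"
  shows "p (Src G \<delta>) = p (Src G \<gamma>)"
  using assms(2)
proof
  assume "(\<delta>, J) \<in> left_slots G V \<gamma>"
  then show ?thesis
    by (auto simp: left_slots_def comp_triples_def Src_Cmp Tgt_Cmp Cmp_Arr)
next
  assume "(\<delta>, J) \<in> right_slots G V \<gamma>"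
  then obtain \<alpha>\<^sub>1 \<alpha>\<^sub>2 \<alpha>\<^sub>3 where "(\<alpha>\<^sub>1, \<alpha>\<^sub>2, \<alpha>\<^sub>3) \<in> comp_triples G \<gamma>" "\<delta> = Cmp G \<alpha>\<^sub>3 \<alpha>\<^sub>2"
    unfolding right_slots_def by blast
  then show ?thesis
    using inv[of \<alpha>\<^sub>1] by (auto simp: comp_triples_def Src_Cmp Tgt_Cmp Cmp_Arr)
qed

lemma shifted_scalar_invariant:
  assumes inv: "\<And>\<alpha>. \<alpha> \<in> Arr G \<Longrightarrow> p (Src G \<alpha>) = p (Tgt G \<alpha>)"
    and x: "x \<in> graded_tensor3 G V \<gamma>"
  shows "shifted_scalar G p x = p (Src G \<gamma>) *\<^sub>C x"
proof (rule poly_mapping_eqI)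
  fix k :: "'g \<times> 'g \<times> 'g"
  obtain \<alpha>\<^sub>1 \<alpha>\<^sub>2 \<alpha>\<^sub>3 where k: "k = (\<alpha>\<^sub>1, \<alpha>\<^sub>2, \<alpha>\<^sub>3)"
    by (cases k)
  show "Poly_Mapping.lookup (shifted_scalar G p x) k
      = Poly_Mapping.lookup (p (Src G \<gamma>) *\<^sub>C x) k"
  proof (cases "k \<in> Poly_Mapping.keys x")
    case True
    then have "(\<alpha>\<^sub>1, \<alpha>\<^sub>2, \<alpha>\<^sub>3) \<in> comp_triples G \<gamma>"
      using x k by (auto simp: graded_tensor3_def direct_sum_def)
    then have "p (Tgt G \<alpha>\<^sub>1) = p (Src G \<gamma>)"
      using inv[of \<alpha>\<^sub>1] by (auto simp: comp_triples_def Src_Cmp Tgt_Cmp Cmp_Arr)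
    then show ?thesis
      using True by (simp add: shifted_scalar_def lookup_mapp lookup_scaleC k)
  next
    case False
    then show ?thesis
      by (simp add: shifted_scalar_def lookup_mapp lookup_scaleC in_keys_iff)
  qed
qed

end

section \<open>The relations on a graded component\<close>

lemma graded_endo_op_inverse:
  assumes "graded_endo G V X" "graded_invertible G V X"
  shows "graded_endo G V (op_inverse G V X)"
  using assms
  by (auto simp: graded_endo_def graded_invertible_def op_inverse_def
      intro: linear_endo_inv_into[OF subspace_graded_tensor2])

lemma graded_endo_combination:
  assumes "graded_endo G V X" "graded_endo G V Y"
  shows "graded_endo G V (\<lambda>a \<gamma> x. b a *\<^sub>C x + c a *\<^sub>C X a \<gamma> x + d a *\<^sub>C Y a \<gamma> x)"
  using assms by (simp add: graded_endo_def linear_endo_combination[OF subspace_graded_tensor2])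

text \<open>The families \<open>K\<close> and \<open>R\<close> in the shape required by \<open>graded_endo_combination\<close>.\<close>

lemma bmw_K_eq:
  "bmw_K G V q U = (\<lambda>a \<gamma> x. 1 *\<^sub>C x + (- (1 / (q a - 1 / q a))) *\<^sub>C U a \<gamma> x
    + (1 / (q a - 1 / q a)) *\<^sub>C op_inverse G V U a \<gamma> x)"
  by (intro ext) (simp add: bmw_K_def cvec.scale_right_diff_distrib)

lemma R_check_eq:
  "R_check G V q \<nu> U u v = (\<lambda>a \<gamma> x. ((q a - 1 / q a) / (v / u - 1)) *\<^sub>C x + 1 *\<^sub>C U a \<gamma> x
    + ((q a - 1 / q a) / (1 + (1 / \<nu> a) * q a * (v / u))) *\<^sub>C bmw_K G V q U a \<gamma> x)"
  by (intro ext) (simp add: R_check_def)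

context groupoid
begin

text \<open>The relations that involve only one position, transferred from \<open>V \<otimes> V\<close> to
  \<open>V \<otimes> V \<otimes> V\<close>.\<close>

lemma slot_relations:
  assumes D: "D = left_slots G V \<gamma> \<or> D = right_slots G V \<gamma>"
    and inv: "\<forall>\<alpha>\<in>Arr G. q (Src G \<alpha>) = q (Tgt G \<alpha>) \<and> \<nu> (Src G \<alpha>) = \<nu> (Tgt G \<alpha>)"
    and BMW: "local_dynamical_BMW G V q \<nu> U"
    and \<gamma>: "\<gamma> \<in> Arr G"
    and f: "acts_in_slots G V \<gamma> D U f" and g: "acts_in_slots G V \<gamma> D (op_inverse G V U) g"
    and k: "acts_in_slots G V \<gamma> D (bmw_K G V q U) k"
    and x: "x \<in> graded_tensor3 G V \<gamma>"
  defines "z \<equiv> q (Src G \<gamma>) - 1 / q (Src G \<gamma>)"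
  shows "f (g x) = x" "g (f x) = x" "f x = g x + z *\<^sub>C x - z *\<^sub>C k x"
    "f (k x) = \<nu> (Src G \<gamma>) *\<^sub>C k x" "k (f x) = \<nu> (Src G \<gamma>) *\<^sub>C k x"
proof -
  let ?T = "graded_tensor2 G V"
  have U: "graded_endo G V U" "graded_invertible G V U"
    using BMW by (auto simp: local_dynamical_BMW_def)
  note U' = graded_endo_op_inverse[OF U]
  have K: "graded_endo G V (bmw_K G V q U)"
    unfolding bmw_K_eq by (rule graded_endo_combination[OF U(1) U'])
  have q: "q (Src G \<delta>) = q (Src G \<gamma>)" and \<nu>: "\<nu> (Src G \<delta>) = \<nu> (Src G \<gamma>)"
    if "(\<delta>, J) \<in> D" for \<delta> J
    using slot_source_invariant[of q \<delta> J V \<gamma>] slot_source_invariant[of \<nu> \<delta> J V \<gamma>] that D inv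
    by auto
  have id: "linear_endo (graded_tensor3 G V \<gamma>) (\<lambda>x. x)"
    by (simp add: linear_endo_def)
  have bij: "bij_betw (U (Src G \<delta>) \<delta>) (?T \<delta>) (?T \<delta>)" if "\<delta> \<in> Arr G" for \<delta>
    using U(2) that Src_Obj by (auto simp: graded_invertible_def)
  show "f (g x) = x"
    by (rule slot_operator_product[OF D f g U' id _ x])
      (simp add: op_inverse_def bij_betw_inv_into_right[OF bij])
  show "g (f x) = x"
    by (rule slot_operator_product[OF D g f U(1) id _ x])
      (simp add: op_inverse_def bij_betw_inv_into_left[OF bij])
  have "k x = 1 *\<^sub>C x + (- (1 / z)) *\<^sub>C f x + (1 / z) *\<^sub>C g x"
    by (rule slot_operator_combination[OF D f g k _ x]) (simp only: bmw_K_eq q z_def)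
  moreover have "z \<noteq> 0"
    using BMW Src_Obj[OF \<gamma>] by (simp add: local_dynamical_BMW_def z_def)
  ultimately show "f x = g x + z *\<^sub>C x - z *\<^sub>C k x"
    by (simp add: scaleC_add_right cvec.scale_right_diff_distrib)
  have twist: "bmw_K G V q U (Src G \<delta>) \<delta> (U (Src G \<delta>) \<delta> y)
      = \<nu> (Src G \<delta>) *\<^sub>C bmw_K G V q U (Src G \<delta>) \<delta> y"
    "U (Src G \<delta>) \<delta> (bmw_K G V q U (Src G \<delta>) \<delta> y)
      = \<nu> (Src G \<delta>) *\<^sub>C bmw_K G V q U (Src G \<delta>) \<delta> y"
    if "\<delta> \<in> Arr G" "y \<in> ?T \<delta>" for \<delta> y
    using BMW that Src_Obj by (auto simp: local_dynamical_BMW_def Let_def)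
  note scaled = linear_endo_scaled[OF subspace_graded_tensor3 acts_in_slots_endo[OF k]]
  show "f (k x) = \<nu> (Src G \<gamma>) *\<^sub>C k x"
    by (rule slot_operator_product[OF D f k K scaled _ x])
      (simp add: twist \<nu> clinear_scale acts_in_slots_apply[OF k])
  show "k (f x) = \<nu> (Src G \<gamma>) *\<^sub>C k x"
    by (rule slot_operator_product[OF D k f U(1) scaled _ x])
      (simp add: twist \<nu> clinear_scale acts_in_slots_apply[OF k])
qed

lemma bmw_strands_on_graded_tensor3:
  assumes inv: "\<forall>\<alpha>\<in>Arr G. q (Src G \<alpha>) = q (Tgt G \<alpha>) \<and> \<nu> (Src G \<alpha>) = \<nu> (Tgt G \<alpha>)"
    and BMW: "local_dynamical_BMW G V q \<nu> U"
    and \<gamma>: "\<gamma> \<in> Arr G" and \<nu>: "\<nu> (Src G \<gamma>) \<noteq> 0"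
  shows "bmw_strands (graded_tensor3 G V \<gamma>)
    (op12 G V U (Src G \<gamma>) \<gamma>) (op12 G V (op_inverse G V U) (Src G \<gamma>) \<gamma>)
    (op23 G V U \<gamma>) (op23 G V (op_inverse G V U) \<gamma>)
    (op12 G V (bmw_K G V q U) (Src G \<gamma>) \<gamma>) (op23 G V (bmw_K G V q U) \<gamma>)
    (q (Src G \<gamma>) - 1 / q (Src G \<gamma>)) (\<nu> (Src G \<gamma>))"
proof -
  have U: "graded_endo G V U" "graded_invertible G V U"
    using BMW by (auto simp: local_dynamical_BMW_def)
  note U' = graded_endo_op_inverse[OF U]
  have K: "graded_endo G V (bmw_K G V q U)"
    unfolding bmw_K_eq by (rule graded_endo_combination[OF U(1) U'])
  note op12 = op12_acts[OF U(1)] op12_acts[OF U'] op12_acts[OF K]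
  note op23 = op23_acts[OF U(1)] op23_acts[OF U'] op23_acts[OF K]
  note left = slot_relations[OF disjI1[OF refl] inv BMW \<gamma> op12]
  note right = slot_relations[OF disjI2[OF refl] inv BMW \<gamma> op23]
  have endo: "linear_endo (graded_tensor3 G V \<gamma>) (op12 G V U (Src G \<gamma>) \<gamma>)"
    "linear_endo (graded_tensor3 G V \<gamma>) (op12 G V (op_inverse G V U) (Src G \<gamma>) \<gamma>)"
    "linear_endo (graded_tensor3 G V \<gamma>) (op12 G V (bmw_K G V q U) (Src G \<gamma>) \<gamma>)"
    "linear_endo (graded_tensor3 G V \<gamma>) (op23 G V U \<gamma>)"
    "linear_endo (graded_tensor3 G V \<gamma>) (op23 G V (op_inverse G V U) \<gamma>)"
    "linear_endo (graded_tensor3 G V \<gamma>) (op23 G V (bmw_K G V q U) \<gamma>)"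
    by (fact op12[THEN acts_in_slots_endo] op23[THEN acts_in_slots_endo])+
  have shifted: "shifted_scalar G (\<lambda>b. \<nu> b powi n) x = \<nu> (Src G \<gamma>) powi n *\<^sub>C x"
    if "x \<in> graded_tensor3 G V \<gamma>" for n x
    using shifted_scalar_invariant[of "\<lambda>b. \<nu> b powi n" x V \<gamma>] inv that by simp
  have z: "q (Src G \<gamma>) - 1 / q (Src G \<gamma>) \<noteq> 0"
    using BMW Src_Obj[OF \<gamma>] by (simp add: local_dynamical_BMW_def)
  let ?S = "graded_tensor3 G V \<gamma>"
  note rel = BMW[unfolded local_dynamical_BMW_def Let_def, THEN conjunct2, THEN conjunct2,
      THEN conjunct2, rule_format, OF Src_Obj[OF \<gamma>] \<gamma> refl]
  note braid = rel[THEN conjunct1, rule_format]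
  note loop23 = rel[THEN conjunct2, THEN conjunct2, THEN conjunct1, rule_format]
  note loop12 = rel[THEN conjunct2, THEN conjunct2, THEN conjunct2, rule_format]
  have loop: "op12 G V (bmw_K G V q U) (Src G \<gamma>) \<gamma>
      (op23 G V U \<gamma> (op12 G V (bmw_K G V q U) (Src G \<gamma>) \<gamma> x))
        = (1 / \<nu> (Src G \<gamma>)) *\<^sub>C op12 G V (bmw_K G V q U) (Src G \<gamma>) \<gamma> x"
    "op12 G V (bmw_K G V q U) (Src G \<gamma>) \<gamma>
      (op23 G V (op_inverse G V U) \<gamma> (op12 G V (bmw_K G V q U) (Src G \<gamma>) \<gamma> x))
        = \<nu> (Src G \<gamma>) *\<^sub>C op12 G V (bmw_K G V q U) (Src G \<gamma>) \<gamma> x"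
    "op23 G V (bmw_K G V q U) \<gamma>
      (op12 G V U (Src G \<gamma>) \<gamma> (op23 G V (bmw_K G V q U) \<gamma> x))
        = (1 / \<nu> (Src G \<gamma>)) *\<^sub>C op23 G V (bmw_K G V q U) \<gamma> x"
    "op23 G V (bmw_K G V q U) \<gamma>
      (op12 G V (op_inverse G V U) (Src G \<gamma>) \<gamma> (op23 G V (bmw_K G V q U) \<gamma> x))
        = \<nu> (Src G \<gamma>) *\<^sub>C op23 G V (bmw_K G V q U) \<gamma> x"
    if x: "x \<in> ?S" for x
    using loop12[OF _ x, of 1] loop12[OF _ x, of "-1"] loop23[OF _ x, of 1] loop23[OF _ x, of "-1"]
      shifted[OF linear_endo_mem[OF endo(6) x], of "-1"]
      shifted[OF linear_endo_mem[OF endo(6) x], of 1]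
    by (simp_all add: op_sign_power_def power_int_minus divide_inverse)
  show ?thesis
    by unfold_locales (fact subspace_graded_tensor3 endo z \<nu> left right braid loop)+
qed

lemma op_R_check:
  assumes inv: "\<forall>\<alpha>\<in>Arr G. q (Src G \<alpha>) = q (Tgt G \<alpha>) \<and> \<nu> (Src G \<alpha>) = \<nu> (Tgt G \<alpha>)"
    and U: "graded_endo G V U" "graded_invertible G V U"
    and x: "x \<in> graded_tensor3 G V \<gamma>"
  defines "z \<equiv> q (Src G \<gamma>) - 1 / q (Src G \<gamma>)"
  shows "op12 G V (R_check G V q \<nu> U u v) (Src G \<gamma>) \<gamma> x = op12 G V U (Src G \<gamma>) \<gamma> x
      + (z / (v / u - 1)) *\<^sub>C x
      + (z / (1 + (1 / \<nu> (Src G \<gamma>)) * q (Src G \<gamma>) * (v / u)))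
        *\<^sub>C op12 G V (bmw_K G V q U) (Src G \<gamma>) \<gamma> x"
    and "op23 G V (R_check G V q \<nu> U u v) \<gamma> x = op23 G V U \<gamma> x
      + (z / (v / u - 1)) *\<^sub>C x
      + (z / (1 + (1 / \<nu> (Src G \<gamma>)) * q (Src G \<gamma>) * (v / u))) *\<^sub>C op23 G V (bmw_K G V q U) \<gamma> x"
proof -
  let ?s = "z / (v / u - 1)" and ?r = "z / (1 + (1 / \<nu> (Src G \<gamma>)) * q (Src G \<gamma>) * (v / u))"
  have K: "graded_endo G V (bmw_K G V q U)"
    unfolding bmw_K_eq by (rule graded_endo_combination[OF U(1) graded_endo_op_inverse[OF U]])
  have R: "graded_endo G V (R_check G V q \<nu> U u v)"
    unfolding R_check_eq by (rule graded_endo_combination[OF U(1) K])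
  have pointwise: "R_check G V q \<nu> U u v (Src G \<delta>) \<delta> y
      = ?s *\<^sub>C y + 1 *\<^sub>C U (Src G \<delta>) \<delta> y + ?r *\<^sub>C bmw_K G V q U (Src G \<delta>) \<delta> y"
    if "(\<delta>, J) \<in> left_slots G V \<gamma> \<or> (\<delta>, J) \<in> right_slots G V \<gamma>" for \<delta> J y
    using slot_source_invariant[of q, OF _ that] slot_source_invariant[of \<nu>, OF _ that] inv
    by (simp add: R_check_def z_def)
  have "op12 G V (R_check G V q \<nu> U u v) (Src G \<gamma>) \<gamma> x = ?s *\<^sub>C x
      + 1 *\<^sub>C op12 G V U (Src G \<gamma>) \<gamma> x + ?r *\<^sub>C op12 G V (bmw_K G V q U) (Src G \<gamma>) \<gamma> x"
    by (rule slot_operator_combination[OF disjI1[OF refl] op12_acts[OF U(1)] op12_acts[OF K]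
          op12_acts[OF R] pointwise[OF disjI1] x])
  then show "op12 G V (R_check G V q \<nu> U u v) (Src G \<gamma>) \<gamma> x = op12 G V U (Src G \<gamma>) \<gamma> x
      + ?s *\<^sub>C x + ?r *\<^sub>C op12 G V (bmw_K G V q U) (Src G \<gamma>) \<gamma> x"
    by simp
  have "op23 G V (R_check G V q \<nu> U u v) \<gamma> x = ?s *\<^sub>C x
      + 1 *\<^sub>C op23 G V U \<gamma> x + ?r *\<^sub>C op23 G V (bmw_K G V q U) \<gamma> x"
    by (rule slot_operator_combination[OF disjI2[OF refl] op23_acts[OF U(1)] op23_acts[OF K]
          op23_acts[OF R] pointwise[OF disjI2] x])
  then show "op23 G V (R_check G V q \<nu> U u v) \<gamma> x = op23 G V U \<gamma> x
      + ?s *\<^sub>C x + ?r *\<^sub>C op23 G V (bmw_K G V q U) \<gamma> x"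
    by simp
qed

end

section \<open>Spectral parameters\<close>

text \<open>The coefficient identities required by \<open>Yang_Baxter\<close>. The first three are partial
  fraction identities with the common factor \<open>z\<^sup>2\<close>; the last one rests on \<open>q z = q\<^sup>2 - 1\<close>.\<close>

lemma spectral_coefficients:
  fixes q \<nu> z x y :: complex
  assumes q: "q \<noteq> 0" and \<nu>: "\<nu> \<noteq> 0" and z: "z = q - 1 / q" "z \<noteq> 0"
    and X: "x - 1 \<noteq> 0" "y - 1 \<noteq> 0" "x * y - 1 \<noteq> 0"
    and P: "1 + 1 / \<nu> * q * x \<noteq> 0" "1 + 1 / \<nu> * q * y \<noteq> 0" "1 + 1 / \<nu> * q * (x * y) \<noteq> 0"
  defines "s \<equiv> \<lambda>t. z / (t - 1)" and "r \<equiv> \<lambda>t. z / (1 + 1 / \<nu> * q * t)"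
  shows "s (x * y) * (z + s x + s y) = s x * s y"
    and "r (x * y) * (z + s x - r y) = s x * r y"
    and "r (x * y) * (z + s y - r x) = s y * r x"
    and "z * \<nu> * s (x * y) - \<nu> * s (x * y) * (r x + r y) + s x * s y * r (x * y)
        + z * r (x * y) * (r x + r y) - z * z * r (x * y)
      = s y * s (x * y) * r x + s x * s (x * y) * r y
        + r x * r y * (1 / \<nu> + s (x * y) * (1 - (\<nu> - 1 / \<nu>) / z) + r (x * y))"
proof -
  \<comment> \<open>With the denominators as atoms, clearing them leaves polynomial identities.\<close>
  define a b c d e f
    where "a = x - 1" and "b = y - 1" and "c = x * y - 1"
      and "d = \<nu> + q * x" and "e = \<nu> + q * y" and "f = \<nu> + q * (x * y)"
  note den = a_def b_def c_def d_def e_def f_def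
  have nonzero: "a \<noteq> 0" "b \<noteq> 0" "c \<noteq> 0" "d \<noteq> 0" "e \<noteq> 0" "f \<noteq> 0"
    using X P \<nu> by (auto simp: den field_simps)
  have s: "s x = z / a" "s y = z / b" "s (x * y) = z / c"
    by (simp_all add: s_def den)
  have r: "r x = \<nu> * z / d" "r y = \<nu> * z / e" "r (x * y) = \<nu> * z / f"
    using \<nu> by (simp_all add: r_def den field_simps)
  show "s (x * y) * (z + s x + s y) = s x * s y"
    unfolding s using nonzero z(2) by (simp add: divide_simps) (simp add: den algebra_simps)
  show "r (x * y) * (z + s x - r y) = s x * r y"
    unfolding s r using nonzero z(2) \<nu> by (simp add: divide_simps) (simp add: den algebra_simps)
  show "r (x * y) * (z + s y - r x) = s y * r x"
    unfolding s r using nonzero z(2) \<nu> by (simp add: divide_simps) (simp add: den algebra_simps)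
  have qz: "q * z = q * q - 1"
    using z q by (simp add: right_diff_distrib)
  show "z * \<nu> * s (x * y) - \<nu> * s (x * y) * (r x + r y) + s x * s y * r (x * y)
        + z * r (x * y) * (r x + r y) - z * z * r (x * y)
      = s y * s (x * y) * r x + s x * s (x * y) * r y
        + r x * r y * (1 / \<nu> + s (x * y) * (1 - (\<nu> - 1 / \<nu>) / z) + r (x * y))"
    unfolding s r using nonzero z(2) \<nu> by (simp add: divide_simps) (unfold den, use qz in algebra)
qed

section \<open>The dynamical Yang--Baxter equation\<close>

text \<open>In degree \<open>\<gamma>\<close> both sides are words in \<open>A + s(t) + r(t) E\<close> and \<open>B + s(t) + r(t) F\<close>, because
  \<open>op_R_check\<close> gives the same scalars \<open>s(t)\<close>, \<open>r(t)\<close> in both positions. That \<open>u\<^sub>1\<close> and \<open>u\<^sub>2\<close> do not vanish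
  makes \<open>u\<^sub>3 / u\<^sub>1\<close> the product of the two other parameters.\<close>

theorem theorem1p4:
  fixes G :: "('o, 'g) groupoid_data"
    and V :: "'g \<Rightarrow> 'v::complex_vector set"
    and q \<nu> :: "'o \<Rightarrow> complex"
    and U :: "('o, 'g, 'v) op_family"
    and u\<^sub>1 u\<^sub>2 u\<^sub>3 :: complex
    and a :: 'o and \<gamma> :: 'g
    and x :: "('g, 'v) tensor3"
  assumes "groupoid G"
    and "graded_finite_type G V"
    and "\<And>b. b \<in> Obj G \<Longrightarrow> q b \<noteq> 0"
    and "\<And>b. b \<in> Obj G \<Longrightarrow> \<nu> b \<noteq> 0"
    and "local_dynamical_BMW G V q \<nu> U"
    and "\<And>\<alpha>. \<alpha> \<in> Arr G \<Longrightarrow> q (Src G \<alpha>) = q (Tgt G \<alpha>) \<and> \<nu> (Src G \<alpha>) = \<nu> (Tgt G \<alpha>)"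
    and "a \<in> Obj G"
    and "R_check_defined q \<nu> u\<^sub>1 u\<^sub>2 a"
    and "R_check_defined q \<nu> u\<^sub>1 u\<^sub>3 a"
    and "R_check_defined q \<nu> u\<^sub>2 u\<^sub>3 a"
    and "\<gamma> \<in> Arr G" "Src G \<gamma> = a"
    and "x \<in> graded_tensor3 G V \<gamma>"
  shows "let R = R_check G V q \<nu> U in
    op12 G V (R u\<^sub>2 u\<^sub>3) a \<gamma> (op23 G V (R u\<^sub>1 u\<^sub>3) \<gamma> (op12 G V (R u\<^sub>1 u\<^sub>2) a \<gamma> x))
      = op23 G V (R u\<^sub>1 u\<^sub>2) \<gamma> (op12 G V (R u\<^sub>1 u\<^sub>3) a \<gamma> (op23 G V (R u\<^sub>2 u\<^sub>3) \<gamma> x))"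
proof -
  interpret groupoid G
    by fact
  note BMW = assms(5) and x = assms(13)
  have inv: "\<forall>\<alpha>\<in>Arr G. q (Src G \<alpha>) = q (Tgt G \<alpha>) \<and> \<nu> (Src G \<alpha>) = \<nu> (Tgt G \<alpha>)"
    using assms(6) by blast
  define z where "z = q a - 1 / q a"
  define s r where "s t = z / (t - 1)" and "r t = z / (1 + (1 / \<nu> a) * q a * t)" for t
  have U: "graded_endo G V U" "graded_invertible G V U" and z: "z \<noteq> 0"
    using BMW assms(7) by (auto simp: local_dynamical_BMW_def z_def)
  interpret bmw_strands "graded_tensor3 G V \<gamma>"
    "op12 G V U a \<gamma>" "op12 G V (op_inverse G V U) a \<gamma>"
    "op23 G V U \<gamma>" "op23 G V (op_inverse G V U) \<gamma>"
    "op12 G V (bmw_K G V q U) a \<gamma>" "op23 G V (bmw_K G V q U) \<gamma>" z "\<nu> a"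
    using bmw_strands_on_graded_tensor3[OF inv BMW assms(11)] assms(4,7,12) by (simp add: z_def)
  have u: "u\<^sub>3 / u\<^sub>1 = u\<^sub>2 / u\<^sub>1 * (u\<^sub>3 / u\<^sub>2)"
    using assms(8,10) by (simp add: R_check_defined_def)
  have defined: "u\<^sub>2 / u\<^sub>1 - 1 \<noteq> 0" "u\<^sub>3 / u\<^sub>2 - 1 \<noteq> 0" "u\<^sub>2 / u\<^sub>1 * (u\<^sub>3 / u\<^sub>2) - 1 \<noteq> 0"
    "1 + 1 / \<nu> a * q a * (u\<^sub>2 / u\<^sub>1) \<noteq> 0" "1 + 1 / \<nu> a * q a * (u\<^sub>3 / u\<^sub>2) \<noteq> 0"
    "1 + 1 / \<nu> a * q a * (u\<^sub>2 / u\<^sub>1 * (u\<^sub>3 / u\<^sub>2)) \<noteq> 0"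
    using assms(8-10) unfolding R_check_defined_def u by blast+
  note coefficients = spectral_coefficients[OF assms(3)[OF assms(7)] assms(4)[OF assms(7)]
      z_def z defined, folded s_def r_def]
  note R = op_R_check[OF inv U, of _ \<gamma>, unfolded assms(12), folded z_def, folded s_def r_def]
  have "op12 G V (R_check G V q \<nu> U u\<^sub>2 u\<^sub>3) a \<gamma> (op23 G V (R_check G V q \<nu> U u\<^sub>1 u\<^sub>3) \<gamma>
      (op12 G V (R_check G V q \<nu> U u\<^sub>1 u\<^sub>2) a \<gamma> x))
    = op23 G V (R_check G V q \<nu> U u\<^sub>1 u\<^sub>2) \<gamma> (op12 G V (R_check G V q \<nu> U u\<^sub>1 u\<^sub>3) a \<gamma>
      (op23 G V (R_check G V q \<nu> U u\<^sub>2 u\<^sub>3) \<gamma> x))"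
    using Yang_Baxter[OF coefficients x] by (simp only: R closed x u)
  then show ?thesis
    by (simp add: Let_def)
qed

end
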